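(* Let $m$ be odd and $\ell\ge3$. If $n=m\ell\to\infty$, then \[ \rho(K_m\,\square\,C_\ell)=\frac1m\log\Bigl(\operatorname{RT}(m+2)\Bigm/\binom{m+1}{(m+1)/2}\Bigr)+O\Bigl(\frac{\log m}{m\ell}\Bigr). \]
   Context: $K_m$ is the complete graph and $C_\ell$ the cycle on $\ell$ vertices; $G\,\square\,H$ is the Cartesian product (vertex set $V(G)\times V(H)$, $(u,v)\sim(u',v')$ iff $u=u'$ and $vv'\in E(H)$, or $v=v'$ and $uu'\in E(G)$). For a graph $G$ on $n$ vertices with even degrees, $\operatorname{EO}(G)$ is the number of orientations of the edges such that each vertex has in-degree equal to out-degree, and $\rho(G)=\frac1n\log\operatorname{EO}(G)$. $\operatorname{RT}(k)=\operatorname{EO}(K_k)$ is the number of regular tournaments on $k$ labelled vertices ($k$ odd).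
   Formalization: The error term log m is replaced by max(1, log m), which is the same for every odd m ≥ 3; for m = 1 the stated error would be 0, which is false because ρ(C_ℓ) = (log 2)/ℓ while the main term is 0. *)

theory Defs
  imports Complex_Main "HOL-Library.Landau_Symbols"
begin

text \<open>Edges are two-element sets of vertices.\<close>

record 'a ugraph =
  verts :: "'a set"
  edges :: "'a set set"

definition complete_graph :: "nat \<Rightarrow> nat ugraph" where
  "complete_graph m = \<lparr>verts = {..<m}, edges = {{u, v} | u v. u < m \<and> v < m \<and> u \<noteq> v}\<rparr>"

text \<open>This is the \<open>l\<close>-vertex cycle only for \<open>l \<ge> 3\<close>; for \<open>l = 1\<close> it contains a singleton
  edge.\<close>

definition cycle_graph :: "nat \<Rightarrow> nat ugraph" where
  "cycle_graph l = \<lparr>verts = {..<l}, edges = {{i, Suc i mod l} | i. i < l}\<rparr>"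

definition cart_prod :: "'a ugraph \<Rightarrow> 'b ugraph \<Rightarrow> ('a \<times> 'b) ugraph" where
  "cart_prod G H =
     \<lparr>verts = verts G \<times> verts H,
      edges = {{(u, v), (u', v')} | u v u' v'.
                 u \<in> verts G \<and> u' \<in> verts G \<and> v \<in> verts H \<and> v' \<in> verts H \<and>
                 (u = u' \<and> {v, v'} \<in> edges H \<or> v = v' \<and> {u, u'} \<in> edges G)}\<rparr>"

text \<open>An orientation is encoded by its set of arcs \<open>(u, v)\<close>, directed from \<open>u\<close> to \<open>v\<close>.\<close>

definition is_orientation :: "'a ugraph \<Rightarrow> ('a \<times> 'a) set \<Rightarrow> bool" where
  "is_orientation G A \<longleftrightarrow>
     (\<forall>(u, v) \<in> A. {u, v} \<in> edges G) \<and>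
     (\<forall>u v. {u, v} \<in> edges G \<longrightarrow> ((u, v) \<in> A) \<noteq> ((v, u) \<in> A))"

definition out_deg :: "('a \<times> 'a) set \<Rightarrow> 'a \<Rightarrow> nat" where
  "out_deg A v = card {w. (v, w) \<in> A}"

definition in_deg :: "('a \<times> 'a) set \<Rightarrow> 'a \<Rightarrow> nat" where
  "in_deg A v = card {w. (w, v) \<in> A}"

definition EO :: "'a ugraph \<Rightarrow> nat" where
  "EO G = card {A. is_orientation G A \<and> (\<forall>v \<in> verts G. in_deg A v = out_deg A v)}"

definition rho :: "'a ugraph \<Rightarrow> real" where
  "rho G = ln (real (EO G)) / real (card (verts G))"

definition RT :: "nat \<Rightarrow> nat" where
  "RT k = EO (complete_graph k)"

text \<open>
  The error term is stated with \<open>max 1 (ln m)\<close> in place of \<open>ln m\<close>. By the lemma below the two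
  agree for \<open>m \<ge> 3\<close>. They differ only for \<open>m = 1\<close>, where an error of \<open>O(0)\<close> would be false: the
  product is then the cycle itself, \<open>rho\<close> is \<open>ln 2 / l\<close>, and the main term is \<open>ln (2 / 2) = 0\<close>.
\<close>

lemma max_1_ln: "max 1 (ln (real m)) = ln (real m)" if "m \<ge> 3" for m
proof -
  have "exp 1 \<le> real m"
    using exp_le that by linarith
  then have "1 \<le> ln (real m)"
    using that by (subst ln_ge_iff) auto
  then show ?thesis
    by simp
qed

end

theory Submission imports Defs "HOL-Analysis.Harmonic_Numbers" begin

text \<open>
  Write \<open>m = 2 * k + 1\<close>. Recording which of the \<open>m\<close> edges between two consecutive layers point
  upwards turns Eulerian orientations of the product into closed walks of length \<open>l\<close>, weighted by
  the matrix \<open>T X Y\<close> that counts the tournaments on \<open>m\<close> vertices whose excess (out-degree minus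
  in-degree) is 2 on \<open>X - Y\<close>, -2 on \<open>Y - X\<close> and 0 elsewhere. It vanishes unless \<open>card X = card Y\<close>,
  and its row sums are largest for \<open>card X = k\<close>. Deleting two vertices of a regular tournament on
  \<open>m + 2\<close> vertices shows that this largest row sum \<open>lam\<close> is exactly
  \<open>RT (m + 2) / ((m + 1) choose (k + 1))\<close>.

  It remains to see that the weight of all closed walks is \<open>lam ^ l\<close> up to a factor polynomial in
  \<open>m\<close>. This follows once \<open>T X Y \<ge> T {} {} / poly m\<close> whenever \<open>card (X - Y) \<le> k / 2 + 1\<close>, since at
  least \<open>2 ^ m / poly m\<close> of the \<open>k\<close>-sets are that close to two given ones. To compare \<open>T\<close> at
  distances \<open>d\<close> and \<open>d + 1\<close>, reverse a path of length at most two from \<open>j\<close> to \<open>i\<close>: double counting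
  gives the average of \<open>1 - 1 / (p + 1)\<close> as the ratio, with \<open>p\<close> the number of such paths. In every
  tournament at most \<open>8 * (\<tau> + 1)\<close> vertices \<open>i\<close> of the same excess as \<open>j\<close> have \<open>p \<le> \<tau>\<close>, so averaging
  over \<open>i\<close> bounds the relative loss of one step by \<open>O (ln m / m)\<close>, and \<open>k / 2 + 1\<close> steps cost only a
  factor polynomial in \<open>m\<close>.
\<close>

section \<open>Tournaments with prescribed excess\<close>

definition tournament :: "'a set \<Rightarrow> ('a \<times> 'a) set \<Rightarrow> bool" where
  "tournament V A \<longleftrightarrow>
     A \<subseteq> V \<times> V \<and> (\<forall>u\<in>V. \<forall>v\<in>V. (u, v) \<in> A \<longleftrightarrow> u \<noteq> v \<and> (v, u) \<notin> A)"

definition excess :: "('a \<times> 'a) set \<Rightarrow> 'a \<Rightarrow> int" where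
  "excess A v = int (out_deg A v) - int (in_deg A v)"

definition tours :: "'a set \<Rightarrow> ('a \<Rightarrow> int) \<Rightarrow> ('a \<times> 'a) set set" where
  "tours V e = {A. tournament V A \<and> (\<forall>v\<in>V. excess A v = e v)}"

lemma tournamentD:
  assumes "tournament V A"
  shows "(u, v) \<in> A \<Longrightarrow> u \<in> V" "(u, v) \<in> A \<Longrightarrow> v \<in> V" "(u, u) \<notin> A"
    "(u, v) \<in> A \<Longrightarrow> (v, u) \<notin> A"
    "u \<in> V \<Longrightarrow> v \<in> V \<Longrightarrow> u \<noteq> v \<Longrightarrow> (u, v) \<in> A \<or> (v, u) \<in> A"
  using assms unfolding tournament_def by blast+

lemma finite_tours [simp]: "finite V \<Longrightarrow> finite (tours V e)"
  by (rule finite_subset [of _ "Pow (V \<times> V)"]) (auto simp: tours_def tournament_def)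

lemma tours_cong: "(\<And>v. v \<in> V \<Longrightarrow> e v = e' v) \<Longrightarrow> tours V e = tours V e'"
  by (auto simp: tours_def)

lemma finite_nbrs:
  assumes "finite V" "tournament V A"
  shows "finite {w. (v, w) \<in> A}" "finite {w. (w, v) \<in> A}"
  by (rule finite_subset [OF _ assms(1)]; use tournamentD(1,2)[OF assms(2)] in blast)+

lemma out_plus_in_deg:
  assumes "finite V" "tournament V A" "v \<in> V"
  shows "out_deg A v + in_deg A v = card V - 1"
proof -
  have "{w. (v, w) \<in> A} \<union> {w. (w, v) \<in> A} = V - {v}"
    using tournamentD[OF assms(2)] assms(3) by blast
  moreover have "{w. (v, w) \<in> A} \<inter> {w. (w, v) \<in> A} = {}"
    using tournamentD[OF assms(2)] by blast
  ultimately show ?thesis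
    using card_Un_disjoint[OF finite_nbrs[OF assms(1,2)], of v v] assms
    unfolding out_deg_def in_deg_def by (metis card_Diff_singleton)
qed

lemma sum_excess:
  assumes "finite V" "tournament V A"
  shows "(\<Sum>v\<in>V. excess A v) = 0"
proof -
  have "(\<Sum>v\<in>V. out_deg A v) = card A"
  proof -
    have "A = Sigma V (\<lambda>v. {w. (v, w) \<in> A})" using tournamentD(1)[OF assms(2)] by auto
    then show ?thesis using card_SigmaI[of V "\<lambda>v. {w. (v, w) \<in> A}"] assms finite_nbrs[OF assms]
      by (simp add: out_deg_def)
  qed
  moreover have "(\<Sum>v\<in>V. in_deg A v) = card A"
  proof -
    have "A\<inverse> = Sigma V (\<lambda>v. {w. (w, v) \<in> A})" using tournamentD(2)[OF assms(2)] by auto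
    then have "card (A\<inverse>) = (\<Sum>v\<in>V. in_deg A v)"
      using card_SigmaI[of V "\<lambda>v. {w. (w, v) \<in> A}"] assms finite_nbrs[OF assms]
      by (simp add: in_deg_def)
    then show ?thesis by simp
  qed
  ultimately show ?thesis
    by (simp add: excess_def sum_subtractf flip: of_nat_sum)
qed

lemma tours_empty:
  assumes "finite V" "(\<Sum>v\<in>V. e v) \<noteq> 0"
  shows "tours V e = {}"
proof -
  have "sum e V = 0" if "A \<in> tours V e" for A
    using that sum_excess[OF assms(1), of A] sum.cong[of V V "excess A" e] by (simp add: tours_def)
  then show ?thesis using assms(2) by blast
qed

section \<open>Degrees and short paths in tournaments\<close>

lemma tournament_subset:
  assumes "tournament V A" "S \<subseteq> V"
  shows "tournament S (A \<inter> S \<times> S)"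
  using assms unfolding tournament_def by blast

text \<open>The excesses inside \<open>S\<close> sum to 0, so they can be neither all negative nor
  all positive. A vertex whose excess is at least 0 has out-degree at least half of
  \<open>card S - 1\<close>, and symmetrically for in-degrees.\<close>

lemma ex_large_degree:
  assumes "finite V" "tournament V A" "S \<subseteq> V" "S \<noteq> {}"
  shows "\<exists>u\<in>S. card S \<le> 2 * card {w\<in>S. (u, w) \<in> A} + 1"
    and "\<exists>u\<in>S. card S \<le> 2 * card {w\<in>S. (w, u) \<in> A} + 1"
proof -
  let ?B = "A \<inter> S \<times> S"
  have fin: "finite S" using assms finite_subset by blast
  note T = tournament_subset[OF assms(2,3)]
  have s0: "(\<Sum>v\<in>S. excess ?B v) = 0" using sum_excess[OF fin T] .
  have o: "out_deg ?B u = card {w\<in>S. (u, w) \<in> A}" "in_deg ?B u = card {w\<in>S. (w, u) \<in> A}" if "u \<in> S"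
    for u
    unfolding out_deg_def in_deg_def using that by (auto intro!: arg_cong[where f=card])
  have d: "out_deg ?B u + in_deg ?B u + 1 = card S" if "u \<in> S" for u
    using out_plus_in_deg[OF fin T that] that fin card_gt_0_iff[of S] by auto
  show "\<exists>u\<in>S. card S \<le> 2 * card {w\<in>S. (u, w) \<in> A} + 1"
  proof (rule ccontr)
    assume c: "\<not> ?thesis"
    have "excess ?B u < 0" if "u \<in> S" for u
      using c o[OF that] d[OF that] that unfolding excess_def by force
    then have "(\<Sum>v\<in>S. excess ?B v) < (\<Sum>v\<in>S. 0)" using fin assms(4) by (intro sum_strict_mono) auto
    then show False using s0 by simp
  qed
  show "\<exists>u\<in>S. card S \<le> 2 * card {w\<in>S. (w, u) \<in> A} + 1"
  proof (rule ccontr)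
    assume c: "\<not> ?thesis"
    have "0 < excess ?B u" if "u \<in> S" for u
      using c o[OF that] d[OF that] that unfolding excess_def by force
    then have "(\<Sum>v\<in>S. 0) < (\<Sum>v\<in>S. excess ?B v)" using fin assms(4) by (intro sum_strict_mono) auto
    then show False using s0 by simp
  qed
qed

text \<open>
  Paths from \<open>u\<close> to \<open>v\<close> of length at most two, represented by their second vertex; \<open>w = v\<close> stands
  for the arc \<open>(u, v)\<close> itself. Hence \<open>paths2 (A\<inverse>) j i\<close> lists the short paths from \<open>i\<close> to \<open>j\<close> by
  their last vertex before \<open>j\<close>.
\<close>

definition paths2 :: "('a \<times> 'a) set \<Rightarrow> 'a \<Rightarrow> 'a \<Rightarrow> 'a set" where
  "paths2 A u v = {w. (u, w) \<in> A \<and> (w = v \<or> (w, v) \<in> A)}"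

lemma finite_paths2: "finite V \<Longrightarrow> tournament V A \<Longrightarrow> finite (paths2 A u v)"
  by (rule finite_subset[OF _ finite_nbrs(1)[of V A u]]) (auto simp: paths2_def)

lemma tournament_converse: "tournament V A \<Longrightarrow> tournament V (A\<inverse>)"
  unfolding tournament_def by blast

lemma excess_eq: 
  assumes "finite V" "tournament V A" "v \<in> V"
  shows "excess A v = 2 * int (out_deg A v) - int (card V) + 1"
  using out_plus_in_deg[OF assms] assms card_gt_0_iff[of V]
  unfolding excess_def by force

text \<open>An out-neighbour of \<open>i\<close> either starts a short path to \<open>j\<close> or
  is an out-neighbour of \<open>j\<close> as well. The common out-neighbours cancel in the
  difference, and the factor 2 comes from \<open>excess_eq\<close>.\<close>

lemma excess_diff_paths2:
  assumes "finite V" "tournament V A" "i \<in> V" "j \<in> V" "i \<noteq> j"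
  shows "excess A i - excess A j = 2 * (int (card (paths2 A i j)) - int (card (paths2 A j i)))"
proof -
  note D = tournamentD[OF assms(2)]
  have *: "out_deg A i = card (paths2 A i j) + card {w. (i, w) \<in> A \<and> (j, w) \<in> A}"
    if "i \<in> V" "j \<in> V" "i \<noteq> j" for i j
  proof -
    have "{w. (i, w) \<in> A} = paths2 A i j \<union> {w. (i, w) \<in> A \<and> (j, w) \<in> A}"
      unfolding paths2_def using D that by blast
    moreover have "paths2 A i j \<inter> {w. (i, w) \<in> A \<and> (j, w) \<in> A} = {}"
      unfolding paths2_def using D that by blast
    moreover have "finite {w. (i, w) \<in> A \<and> (j, w) \<in> A}"
      by (rule finite_subset[OF _ finite_nbrs(1)[OF assms(1,2)]]) auto
    ultimately show ?thesis
      using finite_paths2[OF assms(1,2), of i j] by (simp add: out_deg_def card_Un_disjoint)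
  qed
  have "card {w. (i, w) \<in> A \<and> (j, w) \<in> A} = card {w. (j, w) \<in> A \<and> (i, w) \<in> A}"
    by (rule arg_cong[where f = card]) auto
  moreover note *[OF assms(3-5)] *[OF assms(4,3) assms(5)[symmetric]]
    excess_eq[OF assms(1,2,3)] excess_eq[OF assms(1,2,4)]
  ultimately show ?thesis by simp
qed

text \<open>A path with an inner vertex is listed under that vertex on both sides. The arc from
  \<open>i\<close> to \<open>j\<close> is listed under \<open>j\<close> in
  \<open>paths2 A i j\<close> but under \<open>i\<close> for the converse, so the bijection only
  trades \<open>i\<close> for \<open>j\<close>.\<close>

lemma card_paths2_converse:
  assumes "finite V" "tournament V A" "i \<in> V" "j \<in> V" "i \<noteq> j"
  shows "card (paths2 (A\<inverse>) j i) = card (paths2 A i j)"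
proof -
  note D = tournamentD[OF assms(2)]
  show ?thesis
  proof (rule bij_betw_same_card)
    show "bij_betw (\<lambda>w. if w = i then j else w) (paths2 (A\<inverse>) j i) (paths2 A i j)"
      by (rule bij_betw_byWitness[where f' = "\<lambda>w. if w = j then i else w"])
        (use D assms in \<open>auto simp: paths2_def\<close>)
  qed
qed

text \<open>The counts agree by \<open>excess_diff_paths2\<close>, and the arc between
  \<open>i\<close> and \<open>j\<close> is a short path in one of the two directions, so the common
  count is positive.\<close>

lemma paths2_nonempty:
  assumes "finite V" "tournament V A" "i \<in> V" "j \<in> V" "i \<noteq> j" "excess A i = excess A j"
  shows "card (paths2 A i j) = card (paths2 A j i)" "card (paths2 A j i) \<ge> 1"
proof -
  show eq: "card (paths2 A i j) = card (paths2 A j i)"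
    using excess_diff_paths2[OF assms(1-5)] assms(6) by simp
  have "j \<in> paths2 A i j \<or> i \<in> paths2 A j i"
    using tournamentD[OF assms(2)] assms by (auto simp: paths2_def)
  then have "card (paths2 A i j) \<noteq> 0 \<or> card (paths2 A j i) \<noteq> 0"
    using finite_paths2[OF assms(1,2)] by (metis card_eq_0_iff empty_iff)
  then show "card (paths2 A j i) \<ge> 1" using eq by linarith
qed

text \<open>
  Few vertices of \<open>S\<close> can be joined to \<open>j\<close> by few short paths: some pair \<open>u\<close>, \<open>v\<close> in \<open>S\<close> has about
  \<open>card S / 4\<close> paths \<open>u \<rightarrow> w \<rightarrow> v\<close>, and each such \<open>w\<close> lies on a short path from \<open>u\<close> to \<open>j\<close> or from \<open>j\<close>
  to \<open>v\<close>.
\<close>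

lemma close_vertices:
  assumes "finite V" "tournament V A" "j \<in> V" "S \<subseteq> V - {j}"
    and "\<And>i. i \<in> S \<Longrightarrow> card (paths2 A j i) \<le> \<tau>" "\<And>i. i \<in> S \<Longrightarrow> card (paths2 A i j) \<le> \<tau>"
  shows "card S \<le> 8 * (\<tau> + 1)"
proof (cases "S = {}")
  case False
  note D = tournamentD[OF assms(2)]
  obtain u where u: "u \<in> S" "card S \<le> 2 * card {w\<in>S. (u, w) \<in> A} + 1"
    using ex_large_degree(1)[OF assms(1,2), of S] assms False by blast
  define S' where "S' = {w\<in>S. (u, w) \<in> A}"
  show ?thesis
  proof (cases "S' = {}")
    case True
    then have "card S' = 0" by simp
    then show ?thesis using u(2) unfolding S'_def by simp
  next
    case False
    then obtain v where v: "v \<in> S'" "card S' \<le> 2 * card {w\<in>S'. (w, v) \<in> A} + 1"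
      using ex_large_degree(2)[OF assms(1,2), of S'] assms unfolding S'_def by blast
    have "{w\<in>S'. (w, v) \<in> A} \<subseteq> paths2 A u j \<union> paths2 A j v"
    proof
      fix w assume w: "w \<in> {w\<in>S'. (w, v) \<in> A}"
      then have "w \<in> V" "w \<noteq> j" "(u, w) \<in> A" "(w, v) \<in> A" using assms(4) unfolding S'_def by auto
      then show "w \<in> paths2 A u j \<union> paths2 A j v"
        using D(5)[of w j] assms(3) unfolding paths2_def by auto
    qed
    then have "card {w\<in>S'. (w, v) \<in> A} \<le> card (paths2 A u j \<union> paths2 A j v)"
      using finite_paths2[OF assms(1,2)] by (intro card_mono) auto
    also have "\<dots> \<le> card (paths2 A u j) + card (paths2 A j v)" by (rule card_Un_le)
    also have "\<dots> \<le> 2 * \<tau>" using assms(5)[of v] assms(6)[of u] u v unfolding S'_def by force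
    finally have c1: "card {w\<in>S'. (w, v) \<in> A} \<le> 2 * \<tau>" .
    have c2: "card S \<le> 2 * card S' + 1" using u(2) unfolding S'_def .
    from c1 v(2) have "card S' \<le> 4 * \<tau> + 1" by simp
    with c2 show ?thesis by simp
  qed
qed simp

text \<open>Take out an element \<open>y\<close> with the largest \<open>f y\<close>. The hypothesis
  at \<open>f y\<close> counts all of \<open>S\<close>, so the term of \<open>y\<close> is at most
  \<open>c / card S\<close>; by induction these bounds add up to a harmonic sum.\<close>

lemma sum_inverse_le_harm:
  fixes f :: "'a \<Rightarrow> nat"
  assumes "finite S" "\<And>\<tau>. card {x\<in>S. f x \<le> \<tau>} \<le> c * (\<tau> + 1)"
  shows "(\<Sum>x\<in>S. 1 / (real (f x) + 1)) \<le> real c * harm (card S)"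
  using assms
proof (induction "card S" arbitrary: S)
  case 0
  then show ?case by (simp add: harm_expand)
next
  case (Suc n)
  then have ne: "S \<noteq> {}" by auto
  obtain y where y: "y \<in> S" "\<And>x. x \<in> S \<Longrightarrow> f x \<le> f y"
    using Max_in[of "f ` S"] Max_ge[of "f ` S"] Suc.prems(1) ne
    by (metis (no_types, lifting) finite_imageI image_iff image_is_empty imageI)
  have "{x\<in>S. f x \<le> f y} = S" using y by auto
  then have le: "card S \<le> c * (f y + 1)" using Suc.prems(2)[of "f y"] by simp
  then have le': "real (card S) \<le> real c * (real (f y) + 1)"
    by (metis of_nat_1 of_nat_add of_nat_le_iff of_nat_mult)
  have "card {x \<in> S - {y}. f x \<le> \<tau>} \<le> c * (\<tau> + 1)" for \<tau>
    using Suc.prems(2)[of \<tau>] card_mono[of "{x \<in> S. f x \<le> \<tau>}" "{x \<in> S - {y}. f x \<le> \<tau>}"]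
      Suc.prems(1) by fastforce
  then have IH: "(\<Sum>x\<in>S - {y}. 1 / (real (f x) + 1)) \<le> real c * harm (card (S - {y}))"
    using Suc y by (intro Suc.hyps(1)) auto
  have "1 / (real (f y) + 1) \<le> real c / real (card S)"
    using le' Suc.hyps(2) by (simp add: field_simps)
  moreover have "card (S - {y}) = n" using Suc y by simp
  moreover have "harm (Suc n) = harm n + 1 / (real (Suc n))"
    by (simp add: harm_Suc inverse_eq_divide)
  ultimately show ?case
    using IH Suc.hyps(2)[symmetric] sum.remove[OF Suc.prems(1) y(1), of "\<lambda>x. 1 / (real (f x) + 1)"]
    by (simp add: algebra_simps)
qed

section \<open>Invariance under relabelling of the vertices\<close>

lemma card_tours_le_of_inj:
  assumes "finite W" "bij_betw f V W"
  shows "card (tours V (e \<circ> f)) \<le> card (tours W e)"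
proof (rule card_inj_on_le)
  have inj: "inj_on f V" and im: "f ` V = W" using assms(2) by (auto simp: bij_betw_def)
  have mem: "(f u, f v) \<in> map_prod f f ` A \<longleftrightarrow> (u, v) \<in> A"
    if "A \<subseteq> V \<times> V" "u \<in> V" "v \<in> V" for A u v
  proof
    assume "(f u, f v) \<in> map_prod f f ` A"
    then obtain u' v' where "(u', v') \<in> A" "f u = f u'" "f v = f v'" by auto
    then show "(u, v) \<in> A" using that inj_onD[OF inj] by (metis mem_Sigma_iff subsetD)
  qed force
  show "inj_on ((`) (map_prod f f)) (tours V (e \<circ> f))"
  proof (rule inj_onI)
    fix A B assume A: "A \<in> tours V (e \<circ> f)" and B: "B \<in> tours V (e \<circ> f)"
      and eq: "map_prod f f ` A = map_prod f f ` B"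
    have "A \<subseteq> V \<times> V" "B \<subseteq> V \<times> V" using A B by (auto simp: tours_def tournament_def)
    then have "(u, v) \<in> A \<longleftrightarrow> (u, v) \<in> B" for u v
      using mem[of A u v] mem[of B u v] unfolding eq by (cases "u \<in> V \<and> v \<in> V") auto
    then show "A = B" by auto
  qed
  show "(`) (map_prod f f) ` tours V (e \<circ> f) \<subseteq> tours W e"
  proof clarify
    fix A assume "A \<in> tours V (e \<circ> f)"
    then have t: "tournament V A" and ex: "\<And>v. v \<in> V \<Longrightarrow> excess A v = e (f v)"
      by (auto simp: tours_def)
    note D = tournamentD[OF t]
    have AV: "A \<subseteq> V \<times> V" using t by (auto simp: tournament_def)
    let ?B = "map_prod f f ` A"
    have BW: "?B \<subseteq> W \<times> W" using AV im by auto
    have "tournament W ?B"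
      unfolding tournament_def
    proof (intro conjI ballI BW)
      fix u' v' assume "u' \<in> W" "v' \<in> W"
      then obtain u v where uv: "u \<in> V" "v \<in> V" "u' = f u" "v' = f v" using im by auto
      have "f u = f v \<longleftrightarrow> u = v" using uv inj by (auto dest: inj_onD)
      then show "(u', v') \<in> ?B \<longleftrightarrow> u' \<noteq> v' \<and> (v', u') \<notin> ?B"
        using D(3)[of u] D(4,5)[of u v] D(4)[of v u] uv(1,2)
        unfolding uv(3,4) mem[OF AV uv(1,2)] mem[OF AV uv(2,1)] by blast
    qed
    moreover have "excess ?B (f v) = e (f v)" if v: "v \<in> V" for v
    proof -
      have "w \<in> f ` {w. (v, w) \<in> A}" if "(f v, w) \<in> ?B" for w
      proof -
        from that BW im obtain u where "u \<in> V" "w = f u" by blast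
        then show ?thesis using that mem[OF AV v, of u] by simp
      qed
      moreover have "w \<in> f ` {w. (w, v) \<in> A}" if "(w, f v) \<in> ?B" for w
      proof -
        from that BW im obtain u where "u \<in> V" "w = f u" by blast
        then show ?thesis using that mem[OF AV _ v, of u] by simp
      qed
      ultimately have "{w. (f v, w) \<in> ?B} = f ` {w. (v, w) \<in> A}"
        "{w. (w, f v) \<in> ?B} = f ` {w. (w, v) \<in> A}"
        by force+
      moreover have "inj_on f {w. (v, w) \<in> A}" "inj_on f {w. (w, v) \<in> A}"
        using AV by (auto intro: inj_on_subset[OF inj])
      ultimately have "out_deg ?B (f v) = out_deg A v" "in_deg ?B (f v) = in_deg A v"
        unfolding out_deg_def in_deg_def by (simp_all add: card_image)
      then show ?thesis using ex[OF v] by (simp add: excess_def)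
    qed
    ultimately show "?B \<in> tours W e" using im by (auto simp: tours_def)
  qed
qed (use assms in auto)

lemma card_tours_bij:
  assumes "finite W" "bij_betw f V W"
  shows "card (tours V (e \<circ> f)) = card (tours W e)"
proof (rule antisym)
  show "card (tours V (e \<circ> f)) \<le> card (tours W e)" by (rule card_tours_le_of_inj[OF assms])
  have fV: "finite V" using assms bij_betw_finite by blast
  have "card (tours W (e \<circ> f \<circ> inv_into V f)) \<le> card (tours V (e \<circ> f))"
    by (rule card_tours_le_of_inj[OF fV bij_betw_inv_into[OF assms(2)]])
  also have "tours W (e \<circ> f \<circ> inv_into V f) = tours W e"
    by (rule tours_cong) (use assms(2) in \<open>auto simp: bij_betw_def f_inv_into_f\<close>)
  finally show "card (tours W e) \<le> card (tours V (e \<circ> f))" .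
qed

text \<open>The excess that a layer needs inside itself to balance its vertical arcs:
  \<open>X\<close> holds the vertices that receive an upward arc from the layer below,
  \<open>Y\<close> those that send one to the layer above.\<close>

definition shift :: "'a set \<Rightarrow> 'a set \<Rightarrow> 'a \<Rightarrow> int" where
  "shift X Y v = 2 * of_bool (v \<in> X) - 2 * of_bool (v \<in> Y)"

abbreviation transfer :: "'a set \<Rightarrow> 'a set \<Rightarrow> 'a set \<Rightarrow> nat" where
  "transfer V X Y \<equiv> card (tours V (shift X Y))"

lemma ex_bij_betw_blocks:
  assumes "finite V" "P \<subseteq> V" "Q \<subseteq> V" "P \<inter> Q = {}" "P' \<subseteq> V" "Q' \<subseteq> V" "P' \<inter> Q' = {}"
    and "card P = card P'" "card Q = card Q'"
  shows "\<exists>f. bij_betw f V V \<and> f ` P = P' \<and> f ` Q = Q'"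
proof -
  have fin: "finite P" "finite Q" "finite P'" "finite Q'" using assms finite_subset by blast+
  obtain f where f: "bij_betw f P P'" using finite_same_card_bij[OF fin(1,3) assms(8)] by blast
  obtain g where g: "bij_betw g Q Q'" using finite_same_card_bij[OF fin(2,4) assms(9)] by blast
  have *: "card (V - P - Q) = card V - (card P + card Q)"
    if "P \<subseteq> V" "Q \<subseteq> V" "P \<inter> Q = {}" for P Q :: "'a set"
  proof -
    have "finite (P \<union> Q)" using that assms(1) finite_subset by blast
    then show ?thesis
      using that card_Diff_subset[of "P \<union> Q" V] card_Un_disjoint[of P Q]
        by (simp add: Diff_eq Int_assoc)
  qed
  have "card (V - P - Q) = card (V - P' - Q')"
    using *[of P Q] *[of P' Q'] assms by simp
  then obtain h where h: "bij_betw h (V - P - Q) (V - P' - Q')"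
    using finite_same_card_bij[of "V - P - Q" "V - P' - Q'"] assms(1) by blast
  define F where "F x = (if x \<in> P then f x else if x \<in> Q then g x else h x)" for x
  have "bij_betw F P P' = bij_betw f P P'" "bij_betw F Q Q' = bij_betw g Q Q'"
    "bij_betw F (V - P - Q) (V - P' - Q') = bij_betw h (V - P - Q) (V - P' - Q')"
    by (rule bij_betw_cong; use assms(4) in \<open>auto simp: F_def\<close>)+
  then have F: "bij_betw F P P'" "bij_betw F Q Q'" "bij_betw F (V - P - Q) (V - P' - Q')"
    using f g h by simp_all
  have "bij_betw F (P \<union> Q \<union> (V - P - Q)) (P' \<union> Q' \<union> (V - P' - Q'))"
    by (intro bij_betw_combine F) (use assms in auto)
  moreover have "P \<union> Q \<union> (V - P - Q) = V" "P' \<union> Q' \<union> (V - P' - Q') = V" using assms by auto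
  ultimately show ?thesis using F by (auto simp: bij_betw_def)
qed

text \<open>\<open>shift\<close> sees only \<open>X - Y\<close> and \<open>Y - X\<close>, and a
  permutation of \<open>V\<close> carries these disjoint sets to any two disjoint sets of the same
  sizes.\<close>

lemma card_tours_shift:
  assumes "finite V" "X \<subseteq> V" "Y \<subseteq> V" "X' \<subseteq> V" "Y' \<subseteq> V"
    and "card (X - Y) = card (X' - Y')" "card (Y - X) = card (Y' - X')"
  shows "card (tours V (shift X Y)) = card (tours V (shift X' Y'))"
proof -
  have "\<exists>f. bij_betw f V V \<and> f ` (X - Y) = X' - Y' \<and> f ` (Y - X) = Y' - X'"
    by (rule ex_bij_betw_blocks) (use assms in auto)
  then obtain f where f: "bij_betw f V V" "f ` (X - Y) = X' - Y'" "f ` (Y - X) = Y' - X'"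
    by blast
  have inj: "inj_on f V" using f(1) by (rule bij_betw_imp_inj_on)
  have mem: "f v \<in> X' - Y' \<longleftrightarrow> v \<in> X - Y" "f v \<in> Y' - X' \<longleftrightarrow> v \<in> Y - X" if "v \<in> V" for v
    unfolding f(2,3)[symmetric] using assms(2,3) that
    by (intro inj_on_image_mem_iff[OF inj]; blast)+
  have shift: "shift X Y v = 2 * of_bool (v \<in> X - Y) - 2 * of_bool (v \<in> Y - X)" for X Y and v :: 'a
    by (simp add: shift_def)
  have "shift X Y v = (shift X' Y' \<circ> f) v" if "v \<in> V" for v
    unfolding o_apply shift mem[OF that] ..
  then have "tours V (shift X Y) = tours V (shift X' Y' \<circ> f)"
    by (rule tours_cong)
  then show ?thesis using card_tours_bij[OF assms(1) f(1)] by simp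
qed

lemma tours_shift_empty:
  assumes "finite V" "X \<subseteq> V" "Y \<subseteq> V" "card X \<noteq> card Y"
  shows "tours V (shift X Y) = {}"
proof (rule tours_empty[OF assms(1)])
  have "(\<Sum>v\<in>V. of_bool (v \<in> Z) :: int) = int (card Z)" if "Z \<subseteq> V" for Z
    using that assms(1) by (simp add: of_bool_def sum.If_cases Int_absorb1)
  then have "(\<Sum>v\<in>V. shift X Y v) = 2 * int (card X) - 2 * int (card Y)"
    using assms by (simp add: shift_def sum_subtractf flip: sum_distrib_left)
  then show "(\<Sum>v\<in>V. shift X Y v) \<noteq> 0" using assms(4) by simp
qed

section \<open>Reversing short paths\<close>

text \<open>Both directions of every edge on the path from \<open>j\<close> through \<open>w\<close>
  to \<open>i\<close>, where \<open>w = i\<close> again stands for the direct arc. Taking the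
  symmetric difference with this set reverses the path, and doing so twice changes nothing.\<close>

definition toggle :: "'a \<Rightarrow> 'a \<Rightarrow> 'a \<Rightarrow> ('a \<times> 'a) set" where
  "toggle j i w = {(j, w), (w, j)} \<union> (if w = i then {} else {(w, i), (i, w)})"

lemma tournament_toggle:
  assumes "tournament V A" "i \<in> V" "j \<in> V" "i \<noteq> j" "w \<in> V" "w \<noteq> j"
  shows "tournament V (sym_diff A (toggle j i w))"
proof -
  have *: "(u, v) \<in> toggle j i w \<longleftrightarrow> (v, u) \<in> toggle j i w" "(u, u) \<notin> toggle j i w" for u v
    using assms(4,6) by (auto simp: toggle_def)
  have "toggle j i w \<subseteq> V \<times> V" using assms by (auto simp: toggle_def)
  then show ?thesis using assms(1) * unfolding tournament_def
    by (smt (verit, best) DiffE DiffI Un_iff mem_Sigma_iff subset_iff)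
qed

lemma excess_insert:
  assumes "finite A" "(a, b) \<notin> A"
  shows "excess (insert (a, b) A) v = excess A v + of_bool (v = a) - of_bool (v = b)"
proof -
  have "finite {w. (v, w) \<in> A}"
    using finite_imageI[OF assms(1), of snd] by (rule rev_finite_subset) force
  moreover have "finite {w. (w, v) \<in> A}"
    using finite_imageI[OF assms(1), of fst] by (rule rev_finite_subset) force
  moreover have "{w. (v, w) \<in> insert (a, b) A}
      = (if v = a then insert b {w. (v, w) \<in> A} else {w. (v, w) \<in> A})"
    "{w. (w, v) \<in> insert (a, b) A} = (if v = b then insert a {w. (w, v) \<in> A} else {w. (w, v) \<in> A})"
    by auto
  ultimately show ?thesis using assms(2)
    unfolding excess_def out_deg_def in_deg_def by (cases "v = a"; cases "v = b") auto
qed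

lemma excess_remove:
  assumes "finite A" "(a, b) \<in> A"
  shows "excess (A - {(a, b)}) v = excess A v - of_bool (v = a) + of_bool (v = b)"
  using excess_insert[of "A - {(a, b)}" a b v] assms by (simp add: insert_absorb)

text \<open>An inner vertex keeps one arc in and one arc out on the reversed path, so only the two
  ends change, each by 2.\<close>

lemma excess_toggle:
  assumes "finite V" "tournament V A" "i \<in> V" "j \<in> V" "i \<noteq> j" "w \<in> paths2 A j i"
  shows "excess (sym_diff A (toggle j i w)) v
      = excess A v - 2 * of_bool (v = j) + 2 * of_bool (v = i)"
proof -
  note D = tournamentD[OF assms(2)]
  have fin: "finite A" using assms(1,2) 
    by (intro finite_subset[of A "V \<times> V"]) (auto simp: tournament_def)
  show ?thesis
  proof (cases "w = i")
    case True
    then have ji: "(j, i) \<in> A" "(i, j) \<notin> A" using assms(6) D by (auto simp: paths2_def)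
    then have eq: "sym_diff A (toggle j i w) = insert (i, j) (A - {(j, i)})"
      using True by (auto simp: toggle_def)
    have "excess (insert (i, j) (A - {(j, i)})) v =
        excess (A - {(j, i)}) v + of_bool (v = i) - of_bool (v = j)"
      using fin ji by (intro excess_insert) auto
    then show ?thesis unfolding eq excess_remove[OF fin ji(1)] by simp
  next
    case False
    then have p: "(j, w) \<in> A" "(w, i) \<in> A" "(w, j) \<notin> A" "(i, w) \<notin> A" using assms(6) D
      by (auto simp: paths2_def)
    then have "w \<noteq> j" using D by auto
    have "sym_diff A (toggle j i w) = insert (i, w) (insert (w, j) (A - {(j, w)} - {(w, i)}))"
      using False p assms(5) \<open>w \<noteq> j\<close> by (auto simp: toggle_def)
    then have eq: "sym_diff A (toggle j i w)
        = insert (i, w) (insert (w, j) (A - {(j, w)} - {(w, i)}))" .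
    have "excess (insert (i, w) (insert (w, j) (A - {(j, w)} - {(w, i)}))) v =
        excess (insert (w, j) (A - {(j, w)} - {(w, i)})) v + of_bool (v = i) - of_bool (v = w)"
      using p fin assms(5) False by (intro excess_insert) auto
    moreover have "excess (insert (w, j) (A - {(j, w)} - {(w, i)})) v =
        excess (A - {(j, w)} - {(w, i)}) v + of_bool (v = w) - of_bool (v = j)"
      using p fin by (intro excess_insert) auto
    moreover have "excess (A - {(j, w)} - {(w, i)}) v =
        excess (A - {(j, w)}) v - of_bool (v = w) + of_bool (v = i)"
      using p fin assms(5) by (intro excess_remove) auto
    ultimately show ?thesis unfolding eq excess_remove[OF fin p(1)] by simp
  qed
qed

lemma converse_toggle: "(toggle j i w)\<inverse> = toggle j i w"
  by (auto simp: toggle_def split: if_splits)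

lemma sym_diff_sym_diff: "sym_diff (sym_diff A R) R = A"
  by auto

text \<open>Whether \<open>u\<close> represents a short path from \<open>i\<close> to
  \<open>j\<close> depends only on the arcs \<open>(u, j)\<close> and \<open>(i, u)\<close>. For
  \<open>u\<close> other than \<open>w\<close> and \<open>j\<close> the reversal touches neither of
  them, while the reversed path itself is the new one at \<open>w\<close>.\<close>

lemma paths2_toggle:
  assumes "tournament V A" "i \<noteq> j" "w \<in> paths2 A j i"
  shows "paths2 ((sym_diff A (toggle j i w))\<inverse>) j i = insert w (paths2 (A\<inverse>) j i)"
    and "w \<notin> paths2 (A\<inverse>) j i"
proof -
  note D = tournamentD[OF assms(1)]
  have wj: "w \<noteq> j" using assms(3) D by (auto simp: paths2_def)
  show "w \<notin> paths2 (A\<inverse>) j i" using assms(3) D by (auto simp: paths2_def)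
  have "w \<in> paths2 ((sym_diff A (toggle j i w))\<inverse>) j i"
    using assms D wj by (auto simp: paths2_def toggle_def)
  moreover have "u \<in> paths2 ((sym_diff A (toggle j i w))\<inverse>) j i \<longleftrightarrow> u \<in> paths2 (A\<inverse>) j i" if "u \<noteq> w"
    for u
  proof (cases "u = j")
    case True then show ?thesis using D(3)[of j] wj assms(2) by (auto simp: paths2_def toggle_def)
  next
    case False
    then have "(u, j) \<notin> toggle j i w" "(i, u) \<notin> toggle j i w"
      using that wj assms(2) by (auto simp: toggle_def)
    then show ?thesis by (simp add: paths2_def)
  qed
  ultimately show "paths2 ((sym_diff A (toggle j i w))\<inverse>) j i = insert w (paths2 (A\<inverse>) j i)"
    by (intro set_eqI) (metis insert_iff)
qed

text \<open>
  Double counting of the pairs (tournament, short path from \<open>j\<close> to \<open>i\<close>): reversing the path raises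
  the excess of \<open>i\<close> by 2, lowers that of \<open>j\<close> by 2, and creates exactly one new short path from \<open>i\<close>
  to \<open>j\<close>.
\<close>

lemma card_tours_transfer:
  fixes e :: "'a \<Rightarrow> int"
  assumes "finite V" "i \<in> V" "j \<in> V" "i \<noteq> j" "e i = e j"
  shows "real (card (tours V (e(i := e i + 2, j := e j - 2)))) =
    (\<Sum>A\<in>tours V e. 1 - 1 / (real (card (paths2 A j i)) + 1))"
proof -
  let ?e = "e(i := e i + 2, j := e j - 2)"
  let ?p = "\<lambda>A. card (paths2 A j i)" and ?q = "\<lambda>A. card (paths2 (A\<inverse>) j i)"
  have pq: "?q A = ?p A" if "A \<in> tours V e" for A
  proof -
    have "tournament V A" "excess A i = excess A j" using that assms by (auto simp: tours_def)
    then show ?thesis using paths2_nonempty[of V A i j] card_paths2_converse[of V A i j] assms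
      by simp
  qed
  have tour: "tournament V A" if "A \<in> tours V e'" for A and e' :: "'a \<Rightarrow> int"
    using that by (simp add: tours_def)
  have inV: "w \<in> V" "w \<noteq> j" if "A \<in> tours V e'" "w \<in> paths2 A j i \<or> w \<in> paths2 (A\<inverse>) j i"
    for A w and e' :: "'a \<Rightarrow> int"
    using tournamentD[OF tour[OF that(1)]] that(2) by (auto simp: paths2_def)
  let ?S = "Sigma (tours V e) (\<lambda>A. paths2 A j i)" and ?T =
    "Sigma (tours V ?e) (\<lambda>A. paths2 (A\<inverse>) j i)"
  let ?f = "\<lambda>(A, w). (sym_diff A (toggle j i w), w)"
  have bij: "bij_betw ?f ?S ?T"
  proof (rule bij_betw_byWitness[where f' = ?f])
    show "\<forall>x\<in>?S. ?f (?f x) = x" "\<forall>x\<in>?T. ?f (?f x) = x" by (auto simp: sym_diff_sym_diff)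
    show "?f ` ?S \<subseteq> ?T"
    proof clarify
      fix A w assume A: "A \<in> tours V e" "w \<in> paths2 A j i"
      note t = tour[OF A(1)]
      have "sym_diff A (toggle j i w) \<in> tours V ?e"
        unfolding tours_def using tournament_toggle[OF t assms(2-4)] inV[OF A(1)] A(2)
          excess_toggle[OF assms(1) t assms(2-4) A(2)] A(1) assms(4) by (auto simp: tours_def)
      then show "sym_diff A (toggle j i w) \<in> tours V ?e
          \<and> w \<in> paths2 ((sym_diff A (toggle j i w))\<inverse>) j i"
        using paths2_toggle(1)[OF t assms(4) A(2)] by simp
    qed
    show "?f ` ?T \<subseteq> ?S"
    proof clarify
      fix A w assume A: "A \<in> tours V ?e" "w \<in> paths2 (A\<inverse>) j i"
      note t = tournament_converse[OF tour[OF A(1)]]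
      let ?B = "sym_diff A (toggle j i w)"
      have B: "?B\<inverse> = sym_diff (A\<inverse>) (toggle j i w)"
        using converse_toggle[of j i w] by auto
      have conv: "excess (X\<inverse>) v = - excess X v" for X :: "('a \<times> 'a) set" and v
        by (simp add: excess_def out_deg_def in_deg_def)
      have "excess ?B v = e v" if "v \<in> V" for v
        using excess_toggle[OF assms(1) t assms(2-4) A(2), of v] A(1) that assms(4)
        unfolding B[symmetric] conv by (auto simp: tours_def split: if_splits)
      then have "?B \<in> tours V e"
        unfolding tours_def using tournament_toggle[OF tour[OF A(1)] assms(2-4)] inV[OF A(1)] A(2)
          by auto
      moreover have "w \<in> paths2 ?B j i"
        using paths2_toggle(1)[OF t assms(4) A(2)] unfolding B[symmetric] by simp
      ultimately show "?B \<in> tours V e \<and> w \<in> paths2 ?B j i" by simp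
    qed
  qed
  \<comment> \<open>Each of the \<open>?p A\<close> paths gets weight \<open>1 / (?p A + 1)\<close>.
    Reversal turns this into \<open>1 / ?q B\<close>: there are equally many short paths both ways
    in \<open>A\<close>, and \<open>B\<close> has one more from \<open>i\<close> to
    \<open>j\<close>.\<close>
  have "(\<Sum>A\<in>tours V e. 1 - 1 / (real (?p A) + 1))
      = (\<Sum>A\<in>tours V e. \<Sum>w\<in>paths2 A j i. 1 / (real (?p A) + 1))"
    by (simp add: field_simps)
  also have "\<dots> = (\<Sum>(A, w)\<in>?S. 1 / (real (?p A) + 1))"
    using assms(1) by (intro sum.Sigma ballI finite_tours finite_paths2[OF assms(1)] tour)
  also have "\<dots> = (\<Sum>x\<in>?S. case ?f x of (B, w) \<Rightarrow> 1 / real (?q B))"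
  proof (intro sum.cong refl)
    fix x assume "x \<in> ?S"
    then obtain A w where A: "A \<in> tours V e" "w \<in> paths2 A j i" and x: "x = (A, w)" by blast
    have "?q (sym_diff A (toggle j i w)) = ?p A + 1"
      using paths2_toggle[OF tour[OF A(1)] assms(4) A(2)] pq[OF A(1)]
        finite_paths2[OF assms(1) tournament_converse[OF tour[OF A(1)]]] by simp
    then show "(case x of (A, w) \<Rightarrow> 1 / (real (?p A) + 1)) = (case ?f x of (B, w) \<Rightarrow> 1 / real (?q B))"
      by (simp add: x)
  qed
  also have "\<dots> = (\<Sum>(B, w)\<in>?T. 1 / real (?q B))"
    by (rule sum.reindex_bij_betw[OF bij])
  also have "\<dots> = (\<Sum>B\<in>tours V ?e. \<Sum>w\<in>paths2 (B\<inverse>) j i. 1 / real (?q B))"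
    by (rule sum.Sigma[symmetric, OF finite_tours[OF assms(1)]])
      (intro ballI finite_paths2[OF assms(1)] tournament_converse tour, assumption)
  also have "\<dots> = (\<Sum>B\<in>tours V ?e. 1)"
  proof (intro sum.cong refl)
    fix B assume B: "B \<in> tours V ?e"
    \<comment> \<open>Equal excesses have moved apart by 4, so \<open>B\<close> has two more short
      paths from \<open>i\<close> to \<open>j\<close> than back. Hence \<open>?q B\<close> is
      positive and its weights add up to 1.\<close>
    have "excess B i - excess B j = 4" using B assms by (auto simp: tours_def)
    then have "?q B \<noteq> 0"
      using excess_diff_paths2[OF assms(1) tour[OF B] assms(2-4)]
        card_paths2_converse[OF assms(1) tour[OF B] assms(2-4)]
      by auto
    then show "(\<Sum>w\<in>paths2 (B\<inverse>) j i. 1 / real (?q B)) = 1" by simp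
  qed
  finally show ?thesis by simp
qed

section \<open>Decay of the transfer matrix\<close>

text \<open>\<open>close_vertices\<close> supplies the counts for the harmonic bound. The bound by
  half of \<open>card S\<close> only uses that a short path exists; it keeps the average loss at
  most \<open>1 / 2\<close> even when the harmonic bound is weak.\<close>

lemma sum_inverse_paths2_le:
  assumes "finite V" "tournament V A" "j \<in> V" "S \<subseteq> V - {j}"
    and "\<And>i. i \<in> S \<Longrightarrow> excess A i = excess A j"
  shows "(\<Sum>i\<in>S. 1 / (real (card (paths2 A j i)) + 1)) \<le> 8 * harm (card S)"
    and "(\<Sum>i\<in>S. 1 / (real (card (paths2 A j i)) + 1)) \<le> real (card S) / 2"
proof -
  have fin: "finite S" using assms finite_subset by blast
  have pp: "card (paths2 A i j) = card (paths2 A j i)" "card (paths2 A j i) \<ge> 1" if "i \<in> S" for i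
    using paths2_nonempty[OF assms(1,2), of i j] assms(3,4,5) that by auto
  have "card {i\<in>S. card (paths2 A j i) \<le> \<tau>} \<le> 8 * (\<tau> + 1)" for \<tau>
    by (rule close_vertices[OF assms(1-3)]) (use assms(4) pp in auto)
  from sum_inverse_le_harm[OF fin this]
  show "(\<Sum>i\<in>S. 1 / (real (card (paths2 A j i)) + 1)) \<le> 8 * harm (card S)" by simp
  have "(\<Sum>i\<in>S. 1 / (real (card (paths2 A j i)) + 1)) \<le> (\<Sum>i\<in>S. 1 / 2)"
    using pp(2) by (intro sum_mono) (simp add: field_simps)
  then show "(\<Sum>i\<in>S. 1 / (real (card (paths2 A j i)) + 1)) \<le> real (card S) / 2" by simp
qed

lemma transfer_insert:
  assumes "finite V" "X \<subseteq> V" "Y \<subseteq> V" "X \<inter> Y = {}" "i \<in> V - X - Y" "j \<in> V - X - Y" "i \<noteq> j"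
  shows "real (transfer V (insert i X) (insert j Y)) =
    (\<Sum>A\<in>tours V (shift X Y). 1 - 1 / (real (card (paths2 A j i)) + 1))"
proof -
  have "shift (insert i X) (insert j Y) = (shift X Y)(i := shift X Y i + 2, j := shift X Y j - 2)"
    using assms by (auto simp: shift_def fun_eq_iff)
  then show ?thesis using card_tours_transfer[OF assms(1), of i j "shift X Y"] assms
    by (auto simp: shift_def)
qed

lemma transfer_insert_le:
  assumes "finite V" "X \<subseteq> V" "Y \<subseteq> V" "X \<inter> Y = {}" "i \<in> V - X - Y" "j \<in> V - X - Y" "i \<noteq> j"
  shows "transfer V (insert i X) (insert j Y) \<le> transfer V X Y"
proof -
  have "real (transfer V (insert i X) (insert j Y)) \<le> (\<Sum>A\<in>tours V (shift X Y). 1)"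
    unfolding transfer_insert[OF assms] by (intro sum_mono) auto
  then show ?thesis by simp
qed

lemma one_minus_ge_exp:
  fixes y :: real
  assumes "0 \<le> y" "y \<le> 1 / 2"
  shows "exp (- 2 * y) \<le> 1 - y"
proof -
  have "y * (2 * y) \<le> y * 1" using assms by (intro mult_left_mono) auto
  then have "- 2 * y \<le> ln (1 - y)" using ln_one_minus_pos_lower_bound[OF assms]
    by (simp add: power2_eq_square)
  then show ?thesis using assms by (subst (asm) ln_ge_iff) auto
qed

text \<open>
  By symmetry the left-hand side does not depend on \<open>i\<close>, so \<open>i\<close> may be averaged over all vertices of
  excess 0 other than \<open>j\<close>.
\<close>

lemma transfer_insert_ge:
  assumes "finite V" "X \<subseteq> V" "Y \<subseteq> V" "X \<inter> Y = {}" "i \<in> V - X - Y" "j \<in> V - X - Y" "i \<noteq> j"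
  defines "z \<equiv> card (V - X - Y) - 1"
  shows "real (transfer V (insert i X) (insert j Y))
      \<ge> exp (- 16 * harm z / real z) * real (transfer V X Y)"
proof -
  define S where "S = V - X - Y - {j}"
  have fin: "finite S" "finite X" "finite Y" using assms finite_subset by (auto simp: S_def)
  have cS: "card S = z" unfolding S_def z_def using assms by simp
  have "i \<in> S" using assms by (auto simp: S_def)
  then have z: "z > 0" using cS fin by (metis card_gt_0_iff empty_iff)
  define t where "t = real (transfer V X Y)"
  define t' where "t' = real (transfer V (insert i X) (insert j Y))"
  \<comment> \<open>The smaller of the two bounds in \<open>sum_inverse_paths2_le\<close>, divided
    by \<open>z\<close>. The cap \<open>1 / 2\<close> is the range in which
    \<open>one_minus_ge_exp\<close> applies.\<close>
  define y where "y = min (1 / 2) (8 * harm z / real z)"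
  have sym: "real (transfer V (insert a X) (insert j Y)) = t'" if "a \<in> S" for a
  proof -
    have "insert b X - insert j Y = insert b X" "insert j Y - insert b X = insert j Y"
      "card (insert b X) = Suc (card X)"
      if "b \<in> S" for b
      using that assms(4-7) fin by (auto simp: S_def)
    then have "transfer V (insert a X) (insert j Y) = transfer V (insert i X) (insert j Y)"
      using \<open>i \<in> S\<close> that assms(2-6) by (intro card_tours_shift[OF assms(1)]) (auto simp: S_def)
    then show ?thesis by (simp add: t'_def)
  qed
  have "real z * t' = (\<Sum>a\<in>S. real (transfer V (insert a X) (insert j Y)))"
    using sym cS by simp
  also have "\<dots> = (\<Sum>a\<in>S. \<Sum>A\<in>tours V (shift X Y). 1 - 1 / (real (card (paths2 A j a)) + 1))"
    by (intro sum.cong refl transfer_insert[OF assms(1-4)]) (use assms in \<open>auto simp: S_def\<close>)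
  also have "\<dots> = (\<Sum>A\<in>tours V (shift X Y). \<Sum>a\<in>S. 1 - 1 / (real (card (paths2 A j a)) + 1))"
    by (rule sum.swap)
  also have "\<dots> \<ge> (\<Sum>A\<in>tours V (shift X Y). real z - real z * y)"
  proof (intro sum_mono)
    fix A assume A: "A \<in> tours V (shift X Y)"
    have "(\<Sum>a\<in>S. 1 / (real (card (paths2 A j a)) + 1)) \<le> 8 * harm (card S)"
      "(\<Sum>a\<in>S. 1 / (real (card (paths2 A j a)) + 1)) \<le> real (card S) / 2"
      by (rule sum_inverse_paths2_le[OF assms(1)]; use A assms(6) in \<open>force simp: S_def tours_def
          shift_def\<close>)+
    moreover have "real z * y = min (real z / 2) (8 * harm z)"
      using z by (simp add: y_def min_def field_simps)
    ultimately show "real z - real z * y \<le> (\<Sum>a\<in>S. 1 - 1 / (real (card (paths2 A j a)) + 1))"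
      using cS by (simp add: sum_subtractf)
  qed
  finally have "real z * t' \<ge> real z * ((1 - y) * t)"
    by (simp add: t_def algebra_simps)
  then have "t' \<ge> (1 - y) * t" using z by simp
  moreover have "exp (- 16 * harm z / real z) \<le> 1 - y"
  proof -
    have "exp (- 16 * harm z / real z) \<le> exp (- 2 * y)" by (simp add: y_def)
    also have "\<dots> \<le> 1 - y" using harm_nonneg[of z, where 'a = real]
      by (intro one_minus_ge_exp) (auto simp: y_def)
    finally show ?thesis .
  qed
  ultimately show ?thesis
    using mult_right_mono[of "exp (- 16 * harm z / real z)" "1 - y" t] unfolding t_def t'_def
      by simp
qed

lemma transfer_le_diag:
  assumes "finite V" "X \<subseteq> V" "Y \<subseteq> V" "X \<inter> Y = {}" "card X = card Y"
  shows "transfer V X Y \<le> transfer V {} {}"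
  using assms(2-5)
proof (induction "card X" arbitrary: X Y)
  case 0
  moreover have "finite X" "finite Y" using 0 finite_subset[OF _ assms(1)] by blast+
  ultimately have "X = {}" "Y = {}" by auto
  then show ?case by simp
next
  case (Suc d)
  have fin: "finite X" "finite Y" using Suc.prems(1,2) finite_subset[OF _ assms(1)] by blast+
  from Suc obtain i X' j Y' where X': "X = insert i X'" "i \<notin> X'" "d = card X'"
    and Y': "Y = insert j Y'" "j \<notin> Y'" "d = card Y'" by (metis card_Suc_eq)
  have "transfer V X Y \<le> transfer V X' Y'"
    unfolding X' Y' using Suc.prems X' Y' by (intro transfer_insert_le assms(1)) auto
  also have "\<dots> \<le> transfer V {} {}"
    using Suc.prems X' Y' by (intro Suc.hyps(1)) auto
  finally show ?case .
qed

text \<open>The two sets are built up pair by pair. After \<open>d < card X\<close> pairs there are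
  \<open>card V - 2 * d - 1 \<ge> z\<close> vertices to average over, so each step loses at most a
  factor \<open>exp (16 * harm (card V) / z)\<close>.\<close>

lemma transfer_ge_diag:
  assumes "finite V" "X \<subseteq> V" "Y \<subseteq> V" "X \<inter> Y = {}" "card X = card Y"
    and "0 < z" "z + 2 * card X \<le> card V + 1"
  shows "real (transfer V X Y)
      \<ge> exp (- 16 * real (card X) * harm (card V) / real z) * real (transfer V {} {})"
  using assms(2-5,7)
proof (induction "card X" arbitrary: X Y)
  case 0
  moreover have "finite X" "finite Y" using 0 finite_subset[OF _ assms(1)] by blast+
  ultimately have "X = {}" "Y = {}" by auto
  then show ?case by simp
next
  case (Suc d)
  have fin: "finite X" "finite Y" using Suc.prems(1,2) finite_subset[OF _ assms(1)] by blast+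
  from Suc obtain i X' j Y' where X': "X = insert i X'" "i \<notin> X'" "d = card X'"
    and Y': "Y = insert j Y'" "j \<notin> Y'" "d = card Y'" by (metis card_Suc_eq)
  have cV: "card (V - X' - Y') = card V - 2 * d"
  proof -
    have "V - X' - Y' = V - (X' \<union> Y')" by auto
    moreover have "X' \<inter> Y' = {}" using X' Y' Suc.prems by auto
    ultimately show ?thesis using X' Y' Suc.prems fin card_Un_disjoint[of X' Y']
      by (simp add: card_Diff_subset)
  qed
  define y where "y = card (V - X' - Y') - 1"
  have y: "z \<le> y" "y \<le> card V"
    unfolding y_def cV using Suc.prems(5) Suc.hyps(2) by linarith+
  have h: "harm y / real y \<le> harm (card V) / real z"
    using y assms(6) by (intro frac_le harm_mono harm_nonneg) auto
  have cX': "card X' = card Y'" "z + 2 * card X' \<le> card V + 1"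
    using X'(3) Y'(3) Suc.hyps(2) Suc.prems(5) by linarith+
  have cX: "real (card X) = real (card X') + 1" using X'(3) Suc.hyps(2) by linarith
  have "exp (- 16 * real (card X) * harm (card V) / real z) * real (transfer V {} {})
      = exp (- 16 * harm (card V) / real z) *
        (exp (- 16 * real (card X') * harm (card V) / real z) * real (transfer V {} {}))"
    unfolding mult.assoc[symmetric] exp_add[symmetric] cX
    using assms(6) by (simp add: field_simps)
  also have "\<dots> \<le> exp (- 16 * harm (card V) / real z) * real (transfer V X' Y')"
    using Suc.prems(1-4) X' Y' cX' by (intro mult_left_mono Suc.hyps(1)) auto
  also have "\<dots> \<le> exp (- 16 * harm y / real y) * real (transfer V X' Y')"
    using h by (intro mult_right_mono) auto
  also have "\<dots> \<le> real (transfer V X Y)"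
    unfolding X' Y' y_def using Suc.prems X' Y' by (intro transfer_insert_ge assms(1)) auto
  finally show ?case .
qed

section \<open>Row sums of the transfer matrix\<close>

lemma central_binomial_ge: "2 ^ n \<le> (n choose (n div 2)) * (n + 1)"
proof -
  have "2 ^ n = (\<Sum>k\<le>n. n choose k)" by (simp add: choose_row_sum)
  also have "\<dots> \<le> (\<Sum>k\<le>n. n choose (n div 2))" by (intro sum_mono binomial_maximum)
  finally show ?thesis by (simp add: mult.commute)
qed

text \<open>
  Let \<open>z\<close> contain half of each of \<open>x \<inter> y\<close>, \<open>x - y\<close>, \<open>y - x\<close> and \<open>V - (x \<union> y)\<close>.
\<close>

lemma card_middle_ge:
  fixes x y V :: "'a set"
  assumes "finite V" "card V = 2 * k + 1" "x \<subseteq> V" "y \<subseteq> V" "card x = k" "card y = k"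
  defines "M \<equiv> {z. z \<subseteq> V \<and> card z = k \<and> card (x - z) \<le> k div 2 + 1 \<and> card (y - z) \<le> k div 2 + 1}"
  shows "2 ^ card V \<le> card M * (card V + 1) ^ 4"
proof -
  define R1 R2 R3 R4 where R: "R1 = x \<inter> y" "R2 = x - y" "R3 = y - x" "R4 = V - (x \<union> y)"
  have fin: "finite R1" "finite R2" "finite R3" "finite R4" "finite x" "finite y" "finite M"
    using assms(1,3,4) finite_subset[OF _ assms(1)] unfolding R M_def by auto
  define d where "d = card R2"
  have x: "card x = card R1 + card R2" and y: "card y = card R1 + card R3"
    using card_Int_Diff[OF fin(5), of y] card_Int_Diff[OF fin(6), of x] unfolding R
      by (simp_all add: Int_commute)
  have "x \<union> y = x \<union> R3" "x \<inter> R3 = {}" unfolding R by auto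
  then have "card (x \<union> y) = card x + card R3"
    using card_Un_disjoint[OF fin(5,3)] by simp
  moreover have "card R4 = card V - card (x \<union> y)" unfolding R
    using assms(3,4) fin by (intro card_Diff_subset) auto
  ultimately have "card R4 = 2 * k + 1 - (k + card R3)" using assms(2,5) by simp
  moreover have "card R1 + d = k" "card R1 + card R3 = k" using x y assms(5,6) d_def by simp_all
  ultimately have c: "card R2 = d" "card R3 = d" "card R1 = k - d" "card R4 = k + 1 - d" "d \<le> k"
    unfolding d_def by simp_all
  define F where "F R n = {a. a \<subseteq> R \<and> card a = n}" for R :: "'a set" and n
  \<comment> \<open>The roundings are balanced so that \<open>n1 + n4 = k - d\<close> and
    \<open>n2 + n3 = d\<close>; the chosen halves then have exactly \<open>k\<close> elements
    together.\<close>
  define n1 n2 n3 n4 where n: "n1 = (k - d) div 2" "n2 = d div 2" "n3 = d - d div 2"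
    "n4 = (k + 1 - d) div 2"
  obtain r where r: "k = d + r" using c(5) le_Suc_ex by blast
  have half: "a div 2 + (a + 1) div 2 = a" "a - a div 2 = (a + 1) div 2" for a :: nat by presburger+
  have n': "n1 = r div 2" "n2 = d div 2" "n3 = (d + 1) div 2" "n4 = (r + 1) div 2"
    unfolding n r half(2)[symmetric] by (simp_all add: half)
  have nsum: "n1 + n2 + n3 + n4 = k" using half(1)[of d] half(1)[of r] unfolding n' r by simp
  \<comment> \<open>Rounding half of \<open>card R\<close> up or down gives the same central
    binomial coefficient.\<close>
  have cF: "2 ^ card R \<le> card (F R n) * (card V + 1)"
    if "finite R" "R \<subseteq> V" "n = card R div 2 \<or> n = card R - card R div 2" for R n
  proof -
    have "card (F R n) = card R choose (card R div 2)"
      using that n_subsets[OF that(1), of n] binomial_symmetric[of "card R div 2" "card R"]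
      unfolding F_def by auto
    moreover have "card R \<le> card V" using that assms(1) by (intro card_mono)
    then have "(card R choose (card R div 2)) * (card R + 1)
        \<le> (card R choose (card R div 2)) * (card V + 1)"
      by (intro mult_le_mono2) simp
    ultimately show ?thesis using central_binomial_ge[of "card R"] le_trans by metis
  qed
  let ?g = "\<lambda>(a, b, c, e). a \<union> b \<union> c \<union> e"
  let ?P = "F R1 n1 \<times> F R2 n2 \<times> F R3 n3 \<times> F R4 n4"
  have disj: "R1 \<inter> R2 = {}" "(R1 \<union> R2) \<inter> R3 = {}" "(R1 \<union> R2 \<union> R3) \<inter> R4 = {}" "R1 \<inter> R3 = {}"
    unfolding R by auto
  have inj: "inj_on ?g ?P"
  proof (rule inj_on_inverseI[where g = "\<lambda>u. (u \<inter> R1, u \<inter> R2, u \<inter> R3, u \<inter> R4)"])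
    fix p assume "p \<in> ?P"
    then obtain a b c e where p: "p = (a, b, c, e)" and s: "a \<subseteq> R1" "b \<subseteq> R2" "c \<subseteq> R3" "e \<subseteq> R4"
      unfolding F_def by auto
    have "(a \<union> b \<union> c \<union> e) \<inter> R1 = a" using s(1) disj s(2-4) by blast
    moreover have "(a \<union> b \<union> c \<union> e) \<inter> R2 = b" using s disj by blast
    moreover have "(a \<union> b \<union> c \<union> e) \<inter> R3 = c" using s disj by blast
    moreover have "(a \<union> b \<union> c \<union> e) \<inter> R4 = e" using s disj by blast
    ultimately show "(?g p \<inter> R1, ?g p \<inter> R2, ?g p \<inter> R3, ?g p \<inter> R4) = p" by (simp add: p)
  qed
  have sub: "?g ` ?P \<subseteq> M"
  proof clarify
    fix a1 a2 a3 a4 assume a: "a1 \<in> F R1 n1" "a2 \<in> F R2 n2" "a3 \<in> F R3 n3" "a4 \<in> F R4 n4"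
    let ?z = "a1 \<union> a2 \<union> a3 \<union> a4"
    have fa: "finite a1" "finite a2" "finite a3" "finite a4"
      using a fin finite_subset unfolding F_def by blast+
    have s: "a1 \<subseteq> R1" "a2 \<subseteq> R2" "a3 \<subseteq> R3" "a4 \<subseteq> R4" using a unfolding F_def by auto
    have ca: "card a1 = n1" "card a2 = n2" "card a3 = n3" "card a4 = n4" using a unfolding F_def
      by auto
    have "a1 \<inter> a2 = {}" "(a1 \<union> a2) \<inter> a3 = {}" "(a1 \<union> a2 \<union> a3) \<inter> a4 = {}"
      using s disj by blast+
    then have "card ?z = n1 + n2 + n3 + n4"
      using fa ca by (simp add: card_Un_disjoint)
    moreover have "x - ?z = (R1 - a1) \<union> (R2 - a2)" "y - ?z = (R1 - a1) \<union> (R3 - a3)"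
      using s unfolding R by blast+
    then have "card (x - ?z) \<le> card (R1 - a1) + card (R2 - a2)"
      "card (y - ?z) \<le> card (R1 - a1) + card (R3 - a3)"
      by (simp_all add: card_Un_le)
    moreover have "card (R1 - a1) = k - d - n1" "card (R2 - a2) = d - n2" "card (R3 - a3) = d - n3"
      using s fa ca c by (simp_all add: card_Diff_subset)
    \<comment> \<open>With \<open>k = d + r\<close> both sums are about
      \<open>r / 2 + d / 2\<close>. The roundings cost at most 1, which is the slack in
      \<open>k div 2 + 1\<close>.\<close>
    moreover have "k - d - n1 + (d - n2) \<le> k div 2 + 1" "k - d - n1 + (d - n3) \<le> k div 2 + 1"
    proof -
      have e: "k - d - n1 = (r + 1) div 2" "d - n2 = (d + 1) div 2" "d - n3 = d div 2"
        using half(1)[of r] half(1)[of d] unfolding n' r by linarith+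
      have le: "(r + 1) div 2 + (d + 1) div 2 \<le> (d + r) div 2 + 1" by linarith
      then show "k - d - n1 + (d - n2) \<le> k div 2 + 1" unfolding e by (simp add: r)
      have "d div 2 \<le> (d + 1) div 2" "k div 2 = (d + r) div 2" by (simp_all add: r)
      then show "k - d - n1 + (d - n3) \<le> k div 2 + 1" using le unfolding e by linarith
    qed
    moreover have "?z \<subseteq> V" using s assms(3,4) unfolding R by blast
    ultimately show "?z \<in> M" using nsum unfolding M_def by simp
  qed
  have "2 ^ card V = (2::nat) ^ card R1 * 2 ^ card R2 * 2 ^ card R3 * 2 ^ card R4"
    unfolding power_add[symmetric] using c assms(2) by simp
  also have "\<dots> \<le> (card (F R1 n1) * (card V + 1)) * (card (F R2 n2) * (card V + 1)) *
      (card (F R3 n3) * (card V + 1)) * (card (F R4 n4) * (card V + 1))"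
  proof (intro mult_le_mono)
    have "R1 \<subseteq> V" "R2 \<subseteq> V" "R3 \<subseteq> V" "R4 \<subseteq> V" using assms(3,4) unfolding R by auto
    note cF' = cF[OF fin(1) this(1), of n1] cF[OF fin(2) this(2), of n2]
      cF[OF fin(3) this(3), of n3] cF[OF fin(4) this(4), of n4]
    show "2 ^ card R1 \<le> card (F R1 n1) * (card V + 1)" "2 ^ card R2 \<le> card (F R2 n2) * (card V + 1)"
      "2 ^ card R3 \<le> card (F R3 n3) * (card V + 1)" "2 ^ card R4 \<le> card (F R4 n4) * (card V + 1)"
      by (rule cF'; simp add: c n)+
  qed
  also have "\<dots> = card (?g ` ?P) * (card V + 1) ^ 4"
    unfolding card_image[OF inj] by (simp only: card_cartesian_product power4_eq_xxxx mult_ac)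
  also have "\<dots> \<le> card M * (card V + 1) ^ 4"
    by (intro mult_le_mono1 card_mono fin sub)
  finally show ?thesis .
qed

section \<open>Row sums in terms of distances\<close>

lemma ex_transfer_level:
  assumes "finite V"
  shows "\<exists>t. \<forall>X Y. X \<subseteq> V \<longrightarrow> Y \<subseteq> V \<longrightarrow> card X = card Y \<longrightarrow> transfer V X Y = t (card (X - Y))"
proof -
  \<comment> \<open>\<open>p d\<close> is a representative pair of equally large sets at distance
    \<open>d\<close>, and its entry serves as the value at \<open>d\<close>. If there is no such
    pair the choice is arbitrary.\<close>
  define p where "p d = (SOME p. fst p \<subseteq> V \<and> snd p \<subseteq> V \<and> card (fst p) = card (snd p) \<and> card (fst p -
      snd p) = d)" for d
  have eq: "card (Y - X) = card (X - Y)" if "X \<subseteq> V" "Y \<subseteq> V" "card X = card Y" for X Y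
    using that(3) card_Int_Diff[OF finite_subset[OF that(1) assms], of Y]
      card_Int_Diff[OF finite_subset[OF that(2) assms], of X] by (simp add: Int_commute)
  have "transfer V X Y = transfer V (fst (p (card (X - Y)))) (snd (p (card (X - Y))))"
    if "X \<subseteq> V" "Y \<subseteq> V" "card X = card Y" for X Y
  proof -
    define q where "q = p (card (X - Y))"
    have "fst q \<subseteq> V \<and> snd q \<subseteq> V \<and> card (fst q) = card (snd q) \<and> card (fst q - snd q) = card (X - Y)"
      unfolding q_def p_def by (rule someI[of _ "(X, Y)"]) (use that in simp)
    then show ?thesis unfolding q_def[symmetric]
      using that eq[of X Y] eq[of "fst q" "snd q"] by (intro card_tours_shift assms) auto
  qed
  then show ?thesis by (intro exI[of _ "\<lambda>d. transfer V (fst (p d)) (snd (p d))"]) blast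
qed

text \<open>Such a set is determined by the \<open>j\<close> elements removed from \<open>x\<close>
  and the \<open>j\<close> elements added from outside.\<close>

lemma card_sets_at_distance:
  assumes "finite V" "x \<subseteq> V"
  shows "card {y. y \<subseteq> V \<and> card y = card x \<and> card (x - y) = j}
      = (card x choose j) * ((card V - card x) choose j)"
proof -
  have fin: "finite x" using assms finite_subset by blast
  let ?F = "\<lambda>R. {a. a \<subseteq> R \<and> card a = j}"
  have "bij_betw (\<lambda>y. (x - y, y - x)) {y. y \<subseteq> V \<and> card y = card x \<and> card (x - y) = j}
      (?F x \<times> ?F (V - x))"
  proof (rule bij_betw_byWitness[where f' = "\<lambda>(P, Q). (x - P) \<union> Q"])
    show "(\<lambda>y. (x - y, y - x)) ` {y. y \<subseteq> V \<and> card y = card x \<and> card (x - y) = j} \<subseteq> ?F x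
        \<times> ?F (V - x)"
    proof (rule image_subsetI)
      fix y assume "y \<in> {y. y \<subseteq> V \<and> card y = card x \<and> card (x - y) = j}"
      then have y: "y \<subseteq> V" "card y = card x" "card (x - y) = j" by auto
      have fy: "finite y" using y assms finite_subset by blast
      have "card (x - y) + card (x \<inter> y) = card x" "card (y - x) + card (x \<inter> y) = card y"
        using card_Int_Diff[OF fin, of y] card_Int_Diff[OF fy, of x] by (simp_all add: Int_commute)
      then show "(x - y, y - x) \<in> ?F x \<times> ?F (V - x)"
        using y by auto
    qed
    show "(\<lambda>(P, Q). x - P \<union> Q) ` (?F x \<times> ?F (V - x))
        \<subseteq> {y. y \<subseteq> V \<and> card y = card x \<and> card (x - y) = j}"
    proof (rule image_subsetI)
      fix p assume "p \<in> ?F x \<times> ?F (V - x)"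
      then obtain P Q where p: "p = (P, Q)" and PQ: "P \<subseteq> x" "Q \<subseteq> V - x" "card P = j" "card Q = j"
        by auto
      have f: "finite P" "finite Q" using PQ fin assms finite_subset[of Q V] finite_subset[of P x]
        by auto
      have "card (x - P \<union> Q) = card (x - P) + card Q" using f fin PQ
        by (intro card_Un_disjoint) auto
      also have "\<dots> = card x" using f PQ fin card_mono[of x P] by (simp add: card_Diff_subset)
      finally have "card (x - P \<union> Q) = card x" .
      moreover have "x - (x - P \<union> Q) = P" using PQ by auto
      ultimately show "(case p of (P, Q) \<Rightarrow> x - P \<union> Q) \<in>
          {y. y \<subseteq> V \<and> card y = card x \<and> card (x - y) = j}"
        using PQ assms by (auto simp: p)
    qed
  qed auto
  then show ?thesis
    using bij_betw_same_card n_subsets[OF fin, of j] n_subsets[of "V - x" j] assms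
    by (fastforce simp: card_cartesian_product card_Diff_subset fin)
qed

lemma sum_transfer_eq:
  assumes "finite V" "x \<subseteq> V"
    and t: "\<And>X Y. X \<subseteq> V \<Longrightarrow> Y \<subseteq> V \<Longrightarrow> card X = card Y \<Longrightarrow> transfer V X Y = t (card (X - Y))"
  shows "(\<Sum>y | y \<subseteq> V \<and> card y = card x. transfer V x y) =
    (\<Sum>j\<le>card V. (card x choose j) * ((card V - card x) choose j) * t j)"
proof -
  let ?S = "{y. y \<subseteq> V \<and> card y = card x}"
  have fin: "finite ?S" using assms(1) by simp
  have "(\<Sum>y\<in>?S. transfer V x y) = (\<Sum>y\<in>?S. t (card (x - y)))"
    using assms by (intro sum.cong refl t) auto
  also have "\<dots> = (\<Sum>j\<le>card V. \<Sum>y\<in>{y\<in>?S. card (x - y) = j}. t (card (x - y)))"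
    using assms by (intro sum.group[symmetric] fin) (auto intro!: card_mono)
  also have "\<dots> = (\<Sum>j\<le>card V. card {y\<in>?S. card (x - y) = j} * t j)"
    by (intro sum.cong refl) simp
  also have "\<dots> = (\<Sum>j\<le>card V. (card x choose j) * ((card V - card x) choose j) * t j)"
    using card_sets_at_distance[OF assms(1,2)] by (simp add: conj_assoc)
  finally show ?thesis .
qed

text \<open>Pascal's rule reduces the claim to \<open>(a choose Suc i) * (c choose i) \<le> (a
  choose i) * (c choose Suc i)\<close>, and absorption reduces that to
  \<open>a - i \<le> c - i\<close>. One element moves from the larger size to the smaller.\<close>

lemma binomial_product_step:
  assumes "a \<le> c"
  shows "(a choose j) * (Suc c choose j) \<le> (Suc a choose j) * (c choose j)"
proof (cases j)
  case (Suc i)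
  have absorb: "Suc i * (n choose Suc i) = (n - i) * (n choose i)" for n
    using binomial_absorption[of i n] binomial_absorb_comp[of n i] by simp
  have "Suc i * ((a choose Suc i) * (c choose i)) = (a - i) * ((a choose i) * (c choose i))"
    by (simp only: mult.assoc[symmetric] absorb)
  also have "\<dots> \<le> (c - i) * ((a choose i) * (c choose i))" using assms
    by (intro mult_right_mono) auto
  also have "\<dots> = Suc i * ((a choose i) * (c choose Suc i))"
    using absorb[of c] by (metis mult.assoc mult.commute)
  finally have "(a choose Suc i) * (c choose i) \<le> (a choose i) * (c choose Suc i)"
    by (simp only: Suc_mult_le_cancel1)
  then show ?thesis using Suc by (simp add: algebra_simps)
qed simp

lemma binomial_product_le_middle:
  assumes "a \<le> 2 * k + 1"
  shows "(a choose j) * ((2 * k + 1 - a) choose j) \<le> (k choose j) * (Suc k choose j)"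
proof -
  have *: "(a choose j) * ((2 * k + 1 - a) choose j) \<le> (k choose j) * (Suc k choose j)" if "a \<le> k"
    for a
    using that
  proof (induction rule: inc_induct)
    case base
    have "2 * k + 1 - k = Suc k" by simp
    then show ?case by simp
  next
    case (step n)
    have e: "2 * k + 1 - n = Suc (2 * k - n)" "2 * k + 1 - Suc n = 2 * k - n" using step by simp_all
    have "(n choose j) * (Suc (2 * k - n) choose j) \<le> (Suc n choose j) * (2 * k - n choose j)"
      using step by (intro binomial_product_step) simp
    also have "\<dots> \<le> (k choose j) * (Suc k choose j)" using step.IH unfolding e .
    finally show ?case unfolding e .
  qed
  show ?thesis
  proof (cases "a \<le> k")
    case False
    then have "2 * k + 1 - a \<le> k" "2 * k + 1 - (2 * k + 1 - a) = a" using assms by auto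
    then show ?thesis using *[of "2 * k + 1 - a"] by (simp add: mult.commute)
  qed (rule *)
qed

text \<open>All rows share the same values \<open>t j\<close>, so it suffices to compare their
  coefficients. The first part bounds every row for the upper estimate; the second gives the
  constant row sums that \<open>walk_sum_ge\<close> requires.\<close>

lemma sum_transfer_le_middle:
  assumes "finite V" "card V = 2 * k + 1" "x \<subseteq> V" "x' \<subseteq> V" "card x' = k"
  shows "(\<Sum>y\<in>Pow V. transfer V x y) \<le> (\<Sum>y | y \<subseteq> V \<and> card y = k. transfer V x' y)"
    and "card x = k \<Longrightarrow> (\<Sum>y | y \<subseteq> V \<and> card y = k. transfer V x y)
        = (\<Sum>y | y \<subseteq> V \<and> card y = k. transfer V x' y)"
proof -
  obtain t where t: "\<And>X Y. X \<subseteq> V \<Longrightarrow> Y \<subseteq> V \<Longrightarrow> card X = card Y \<Longrightarrow> transfer V X Y = t (card (X - Y))"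
    using ex_transfer_level[OF assms(1)] by blast
  have eq: "(\<Sum>y | y \<subseteq> V \<and> card y = card x. transfer V x y) =
      (\<Sum>j\<le>card V. (card x choose j) * ((card V - card x) choose j) * t j)" if "x \<subseteq> V" for x
    by (rule sum_transfer_eq[OF assms(1) that]) (rule t)
  have k: "2 * k + 1 - k = Suc k" by simp
  have "(\<Sum>y\<in>Pow V. transfer V x y) = (\<Sum>y | y \<subseteq> V \<and> card y = card x. transfer V x y)"
  proof (intro sum.mono_neutral_right ballI)
    fix y assume "y \<in> Pow V - {y. y \<subseteq> V \<and> card y = card x}"
    then have "tours V (shift x y) = {}" by (intro tours_shift_empty assms) auto
    then show "transfer V x y = 0" by simp
  qed (use assms(1) in auto)
  also have "\<dots> \<le> (\<Sum>j\<le>card V. (k choose j) * (Suc k choose j) * t j)"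
    unfolding eq[OF assms(3)] assms(2) using card_mono[OF assms(1,3)] assms(2)
    by (intro sum_mono mult_right_mono binomial_product_le_middle) auto
  also have "\<dots> = (\<Sum>y | y \<subseteq> V \<and> card y = k. transfer V x' y)"
    using eq[OF assms(4)] assms(2,5) k by simp
  finally show "(\<Sum>y\<in>Pow V. transfer V x y) \<le> (\<Sum>y | y \<subseteq> V \<and> card y = k. transfer V x' y)" .
  show "card x = k \<Longrightarrow> (\<Sum>y | y \<subseteq> V \<and> card y = k. transfer V x y)
      = (\<Sum>y | y \<subseteq> V \<and> card y = k. transfer V x' y)"
    using eq[OF assms(3)] eq[OF assms(4)] assms(5) by simp
qed

section \<open>Regular tournaments\<close>

lemma is_orientation_complete_graph:
  "is_orientation (complete_graph m) A \<longleftrightarrow> tournament {..<m} A"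
proof -
  have e: "{u, v} \<in> edges (complete_graph m) \<longleftrightarrow> u < m \<and> v < m \<and> u \<noteq> v" for u v
    by (auto simp: complete_graph_def doubleton_eq_iff)
  have "(\<forall>(u, v)\<in>A. {u, v} \<in> edges (complete_graph m)) \<longleftrightarrow> (\<forall>u v. (u, v) \<in> A \<longrightarrow> u < m \<and> v < m \<and> u \<noteq> v)"
    unfolding e by auto
  moreover have "A \<subseteq> {..<m} \<times> {..<m} \<longleftrightarrow> (\<forall>u v. (u, v) \<in> A \<longrightarrow> u < m \<and> v < m)" by auto
  ultimately show ?thesis
    unfolding is_orientation_def tournament_def e by (simp add: Ball_def) blast
qed

lemma EO_complete_graph: "EO (complete_graph m) = card (tours {..<m} (\<lambda>_. 0))"
proof -
  have "in_deg A v = out_deg A v \<longleftrightarrow> excess A v = 0" for A and v :: nat by (auto simp: excess_def)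
  then show ?thesis
    unfolding EO_def tours_def is_orientation_complete_graph by (simp add: complete_graph_def)
qed

definition add_vertex :: "'a set \<Rightarrow> 'a \<Rightarrow> 'a set \<Rightarrow> ('a \<times> 'a) set \<Rightarrow> ('a \<times> 'a) set" where
  "add_vertex V a X B = B \<union> {a} \<times> X \<union> (V - X) \<times> {a}"

lemma tournament_add_vertex:
  assumes "a \<notin> V" "X \<subseteq> V" "tournament V B"
  shows "tournament (insert a V) (add_vertex V a X B)"
proof -
  have BV: "B \<subseteq> V \<times> V" using assms(3) by (simp add: tournament_def)
  have aB: "(a, v) \<notin> B" "(v, a) \<notin> B" for v using BV assms(1) by auto
  have mem: "(u, v) \<in> add_vertex V a X B
      \<longleftrightarrow> (if u = a then v \<in> X else if v = a then u \<in> V - X else (u, v) \<in> B)" for u v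
    using aB assms(1,2) by (auto simp: add_vertex_def)
  have "add_vertex V a X B \<subseteq> insert a V \<times> insert a V"
    using BV assms(2) by (auto simp: add_vertex_def)
  moreover have "(u, v) \<in> add_vertex V a X B \<longleftrightarrow> u \<noteq> v \<and> (v, u) \<notin> add_vertex V a X B"
    if uv: "u \<in> insert a V" "v \<in> insert a V" for u v
  proof -
    have "(u, v) \<in> B \<longleftrightarrow> u \<noteq> v \<and> (v, u) \<notin> B" if "u \<in> V" "v \<in> V"
      using that assms(3) unfolding tournament_def by blast
    moreover consider "u = a" "v = a" | "u = a" "v \<in> V" "v \<noteq> a" | "u \<in> V" "u \<noteq> a" "v = a"
      | "u \<in> V" "u \<noteq> a" "v \<in> V" "v \<noteq> a"
      using uv by blast
    ultimately show ?thesis using assms(1,2) by cases (simp_all add: mem, blast+)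
  qed
  ultimately show ?thesis unfolding tournament_def by (intro conjI ballI)
qed

lemma tournament_decompose:
  assumes "a \<notin> V" "tournament (insert a V) A"
  shows "add_vertex V a {v. (a, v) \<in> A} (A \<inter> V \<times> V) = A"
proof (intro set_eqI; clarify)
  fix u v
  show "(u, v) \<in> add_vertex V a {v. (a, v) \<in> A} (A \<inter> V \<times> V) \<longleftrightarrow> (u, v) \<in> A"
  proof (cases "u = a \<or> v = a")
    case True
    then show ?thesis
      using assms(1) tournamentD(1,2,4,5)[OF assms(2), of u v] tournamentD(3)[OF assms(2), of a]
        tournamentD(4)[OF assms(2), of v u]
      unfolding add_vertex_def by blast
  next
    case False
    then show ?thesis using tournamentD(1,2)[OF assms(2), of u v] unfolding add_vertex_def by blast
  qed
qed

lemma excess_add_vertex: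
  assumes "finite V" "a \<notin> V" "X \<subseteq> V" "tournament V B"
  shows "v \<in> V \<Longrightarrow> excess (add_vertex V a X B) v = excess B v - (if v \<in> X then 1 else - 1)"
    and "excess (add_vertex V a X B) a = 2 * int (card X) - int (card V)"
proof -
  have BV: "B \<subseteq> V \<times> V" using assms(4) by (simp add: tournament_def)
  have fX: "finite X" using assms finite_subset by blast
  show "excess (add_vertex V a X B) v = excess B v - (if v \<in> X then 1 else - 1)" if v: "v \<in> V"
  proof -
    have "{w. (v, w) \<in> add_vertex V a X B}
        = (if v \<in> X then {w. (v, w) \<in> B} else insert a {w. (v, w) \<in> B})"
      "{w. (w, v) \<in> add_vertex V a X B}
          = (if v \<in> X then insert a {w. (w, v) \<in> B} else {w. (w, v) \<in> B})"
      using v assms(2) by (auto simp: add_vertex_def)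
    moreover have "a \<notin> {w. (v, w) \<in> B}" "a \<notin> {w. (w, v) \<in> B}" using BV assms(2) by auto
    ultimately show ?thesis
      using finite_nbrs[OF assms(1,4), of v] unfolding excess_def out_deg_def in_deg_def by auto
  qed
  have "{w. (a, w) \<in> add_vertex V a X B} = X" "{w. (w, a) \<in> add_vertex V a X B} = V - X"
    using BV assms(2,3) by (auto simp: add_vertex_def)
  then show "excess (add_vertex V a X B) a = 2 * int (card X) - int (card V)"
    using card_mono[OF assms(1,3)] assms(3) fX
    unfolding excess_def out_deg_def in_deg_def by (simp add: card_Diff_subset of_nat_diff)
qed

text \<open>Sort by the out-neighbourhood \<open>X\<close> of \<open>a\<close>. The arcs at
  \<open>a\<close> lower the excess by 1 on \<open>X\<close> and raise it by 1 elsewhere, which the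
  tournament on \<open>V\<close> has to offset; the excess of \<open>a\<close> fixes
  \<open>card X\<close>.\<close>

lemma card_tours_insert:
  assumes "finite V" "a \<notin> V"
  shows "card (tours (insert a V) e) =
    (\<Sum>X | X \<subseteq> V \<and> 2 * int (card X) - int (card V) = e a. card (tours V (\<lambda>v. e v + (if v \<in> X then 1
      else - 1))))"
proof -
  let ?I = "{X. X \<subseteq> V \<and> 2 * int (card X) - int (card V) = e a}"
  let ?T = "\<lambda>X. tours V (\<lambda>v. e v + (if v \<in> X then 1 else - 1))"
  let ?f = "\<lambda>(X, B). add_vertex V a X B" and ?g = "\<lambda>A. ({v. (a, v) \<in> A}, A \<inter> V \<times> V)"
  have inv: "?g (add_vertex V a X B) = (X, B)" if "X \<subseteq> V" "tournament V B" for X B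
    using that assms(2) unfolding add_vertex_def tournament_def by auto
  have bij: "bij_betw ?f (Sigma ?I ?T) (tours (insert a V) e)"
  proof (rule bij_betw_byWitness[where f' = ?g])
    show "\<forall>p\<in>Sigma ?I ?T. ?g (?f p) = p" using inv by (auto simp: tours_def)
    show "\<forall>A\<in>tours (insert a V) e. ?f (?g A) = A"
      using tournament_decompose[OF assms(2)] by (auto simp: tours_def)
    show "?f ` Sigma ?I ?T \<subseteq> tours (insert a V) e"
    proof (rule image_subsetI)
      fix p assume "p \<in> Sigma ?I ?T"
      then obtain X B where p: "p = (X, B)" "X \<subseteq> V" "2 * int (card X) - int (card V) = e a"
        "B \<in> ?T X" by auto
      then have t: "tournament V B" by (simp add: tours_def)
      show "?f p \<in> tours (insert a V) e"
        using p tournament_add_vertex[OF assms(2) p(2) t] excess_add_vertex[OF assms p(2) t]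
        by (auto simp: tours_def)
    qed
    show "?g ` tours (insert a V) e \<subseteq> Sigma ?I ?T"
    proof (rule image_subsetI)
      fix A assume A: "A \<in> tours (insert a V) e"
      then have t: "tournament (insert a V) A" by (simp add: tours_def)
      define X B where "X = {v. (a, v) \<in> A}" and "B = A \<inter> V \<times> V"
      have X: "X \<subseteq> V" using tournamentD(2,3)[OF t] unfolding X_def by blast
      have B: "tournament V B" unfolding B_def by (rule tournament_subset[OF t]) auto
      have eq: "A = add_vertex V a X B" unfolding X_def B_def
        using tournament_decompose[OF assms(2) t] by simp
      have "X \<in> ?I" using X excess_add_vertex(2)[OF assms X B] A unfolding eq[symmetric]
        by (simp add: tours_def)
      moreover have "excess B v = e v + (if v \<in> X then 1 else - 1)" if "v \<in> V" for v
        using excess_add_vertex(1)[OF assms X B that] A that unfolding eq[symmetric]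
          by (simp add: tours_def)
      then have "B \<in> ?T X" using B by (simp add: tours_def)
      ultimately show "?g A \<in> Sigma ?I ?T" unfolding X_def B_def by simp
    qed
  qed
  have "card (tours (insert a V) e) = card (Sigma ?I ?T)"
    by (rule bij_betw_same_card[OF bij, symmetric])
  also have "\<dots> = (\<Sum>X\<in>?I. card (?T X))" using assms(1) by (intro card_SigmaI) auto
  finally show ?thesis .
qed

lemma card_tours_sign:
  assumes "finite V" "X \<subseteq> V" "Y \<subseteq> V" "card X = card Y"
  shows "card (tours V (\<lambda>v. if v \<in> X then 1 else - 1))
      = card (tours V (\<lambda>v. if v \<in> Y then 1 else - 1))"
proof -
  have "\<exists>f. bij_betw f V V \<and> f ` X = Y \<and> f ` {} = {}"
    by (rule ex_bij_betw_blocks) (use assms in auto)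
  then obtain f where f: "bij_betw f V V" "f ` X = Y" by blast
  have "f v \<in> Y \<longleftrightarrow> v \<in> X" if "v \<in> V" for v
    unfolding f(2)[symmetric] using assms(2) that
      by (intro inj_on_image_mem_iff[OF bij_betw_imp_inj_on[OF f(1)]])
  then have "tours V (\<lambda>v. if v \<in> X then 1 else - 1) = tours V ((\<lambda>v. if v \<in> Y then 1 else - 1) \<circ> f)"
    by (intro tours_cong) simp
  then show ?thesis using card_tours_bij[OF assms(1) f(1)] by simp
qed

lemma transfer_commute:
  assumes "finite V" "X \<subseteq> V" "Y \<subseteq> V" "card X = card Y"
  shows "transfer V X Y = transfer V Y X"
proof (rule card_tours_shift[OF assms(1-3,3,2)])
  show "card (X - Y) = card (Y - X)"
    using assms(4) card_Int_Diff[OF finite_subset[OF assms(2,1)], of Y]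
      card_Int_Diff[OF finite_subset[OF assms(3,1)], of X] by (simp add: Int_commute)
  then show "card (Y - X) = card (X - Y)" ..
qed

text \<open>
  Delete two vertices: by symmetry every out-neighbourhood of the first one contributes equally, and
  the out-neighbourhoods of the second one run through a row of the transfer matrix.
\<close>

lemma RT_eq:
  assumes "m = 2 * k + 1" "x \<subseteq> {..<m}" "card x = k"
  shows "RT (m + 2) = ((m + 1) choose (k + 1))
      * (\<Sum>y | y \<subseteq> {..<m} \<and> card y = k. transfer {..<m} x y)"
proof -
  let ?V = "{..<m}" and ?W = "{..<m + 1}"
  have W: "?W = insert m ?V" "{..<m + 2} = insert (m + 1) ?W" by auto
  \<comment> \<open>The representative for the out-neighbourhood of the first deleted vertex
    \<open>m + 1\<close>. It makes \<open>s Y v + s X v\<close> equal to \<open>shift X x v\<close>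
    on \<open>?V\<close>, and since it avoids \<open>m\<close>, the vertex \<open>m\<close> needs
    excess \<open>- 1\<close> inside \<open>?W\<close>, hence out-degree \<open>k\<close>.\<close>
  define Y where "Y = ?V - x"
  have Y: "Y \<subseteq> ?V" "card Y = k + 1" "m \<notin> Y"
    using assms card_Diff_subset[of x ?V] finite_subset[OF assms(2)] unfolding Y_def by auto
  define s where "s X v = (if v \<in> X then 1 else - 1 :: int)" for X :: "nat set" and v
  have "RT (m + 2) = (\<Sum>X | X \<subseteq> ?W \<and> 2 * int (card X) - int (card ?W) = 0. card (tours ?W (\<lambda>v. 0 + s
      X v)))"
    unfolding RT_def EO_complete_graph W(2) s_def by (rule card_tours_insert) auto
  also have "\<dots> = (\<Sum>X | X \<subseteq> ?W \<and> card X = k + 1. card (tours ?W (s X)))"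
    using assms(1) by (intro sum.cong) auto
  also have "\<dots> = (\<Sum>X | X \<subseteq> ?W \<and> card X = k + 1. card (tours ?W (s Y)))"
    unfolding s_def using Y by (intro sum.cong refl card_tours_sign) auto
  also have "\<dots> = ((m + 1) choose (k + 1)) * card (tours ?W (s Y))"
    using n_subsets[of ?W "k + 1"] by simp
  also have "card (tours ?W (s Y)) =
      (\<Sum>X | X \<subseteq> ?V \<and> 2 * int (card X) - int (card ?V) = s Y m. card (tours ?V (\<lambda>v. s Y v + s X v)))"
    unfolding W(1) s_def by (rule card_tours_insert) auto
  also have "\<dots> = (\<Sum>X | X \<subseteq> ?V \<and> card X = k. transfer ?V x X)"
  proof (intro sum.cong)
    show "{X. X \<subseteq> ?V \<and> 2 * int (card X) - int (card ?V) = s Y m} = {X. X \<subseteq> ?V \<and> card X = k}"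
      using Y assms(1) by (auto simp: s_def)
    fix X assume X: "X \<in> {X. X \<subseteq> ?V \<and> card X = k}"
    have "tours ?V (\<lambda>v. s Y v + s X v) = tours ?V (shift X x)"
      by (intro tours_cong) (auto simp: s_def shift_def Y_def)
    then show "card (tours ?V (\<lambda>v. s Y v + s X v)) = transfer ?V x X"
      using transfer_commute[of ?V X x] X assms(2,3) by simp
  qed
  finally show ?thesis .
qed

section \<open>Eulerian orientations as closed walks\<close>

lemma edges_cart_prod_complete_cycle:
  assumes "3 \<le> l"
  shows "{(u, i), (v, j)} \<in> edges (cart_prod (complete_graph m) (cycle_graph l)) \<longleftrightarrow>
    u < m \<and> v < m \<and> i < l \<and> j < l \<and> (u = v \<and> (j = Suc i mod l \<or> i = Suc j mod l) \<or> i = j \<and> u \<noteq> v)"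
proof -
  have e1: "{u, v} \<in> edges (complete_graph m) \<longleftrightarrow> u < m \<and> v < m \<and> u \<noteq> v" for u v
    by (auto simp: complete_graph_def doubleton_eq_iff)
  have e2: "{i, j} \<in> edges (cycle_graph l) \<longleftrightarrow> i < l \<and> j < l \<and> (j = Suc i mod l \<or> i = Suc j mod l)"
    for i j
    using assms by (auto simp: cycle_graph_def doubleton_eq_iff)
  have verts: "verts (complete_graph m) = {..<m}" "verts (cycle_graph l) = {..<l}"
    by (simp_all add: complete_graph_def cycle_graph_def)
  have "{(u, i), (v, j)} \<in> edges (cart_prod (complete_graph m) (cycle_graph l)) \<longleftrightarrow>
    u < m \<and> v < m \<and> i < l \<and> j < l \<and>
      (u = v \<and> {i, j} \<in> edges (cycle_graph l) \<or> i = j \<and> {u, v} \<in> edges (complete_graph m))"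
    (is "_ \<longleftrightarrow> ?R")
  proof
    assume "{(u, i), (v, j)} \<in> edges (cart_prod (complete_graph m) (cycle_graph l))"
    then obtain u0 v0 i0 j0 where 0: "{(u, i), (v, j)} = {(u0, i0), (v0, j0)}" "u0 < m" "v0 < m"
      "i0 < l" "j0 < l"
      "u0 = v0 \<and> {i0, j0} \<in> edges (cycle_graph l) \<or> i0 = j0 \<and> {u0, v0} \<in> edges (complete_graph m)"
      unfolding cart_prod_def verts by (simp only: ugraph.simps mem_Collect_eq lessThan_iff) blast
    from 0(1) consider "u = u0" "i = i0" "v = v0" "j = j0" | "u = v0" "i = j0" "v = u0" "j = i0"
      by (auto simp: doubleton_eq_iff)
    then show ?R using 0 by cases (auto simp: insert_commute)
  next
    assume ?R
    then show "{(u, i), (v, j)} \<in> edges (cart_prod (complete_graph m) (cycle_graph l))"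
      unfolding cart_prod_def verts by (simp only: ugraph.simps mem_Collect_eq lessThan_iff) blast
  qed
  then show ?thesis unfolding e1 e2 by blast
qed

text \<open>For \<open>l \<ge> 3\<close> the layers above and below a given one differ, so the two
  vertical edges at a vertex are distinct and each has a well-defined lower end.\<close>

lemma cyclic_succ:
  assumes "3 \<le> l" "i < l"
  defines "s \<equiv> (\<lambda>i. Suc i mod l)" and "p \<equiv> (\<lambda>i. (i + l - 1) mod l)"
  shows "s i < l" "p i < l" "s (p i) = i" "p (s i) = i" "s i \<noteq> i" "p i \<noteq> i" "s i \<noteq> p i"
    "s (s i) \<noteq> i"
proof -
  obtain n where n: "l = n + 3" using assms(1) by (metis add.commute le_Suc_ex)
  have s: "s i = (if i = n + 2 then 0 else i + 1)" and p: "p i = (if i = 0 then n + 2 else i - 1)"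
    if "i < l" for i
    using that by (auto simp: s_def p_def n mod_if)
  have i: "s i < l" "p i < l" using s[OF assms(2)] p[OF assms(2)] assms(2) n
    by (auto split: if_splits)
  show "s i < l" "p i < l" by (fact i)+
  have "s (p i) = (if p i = n + 2 then 0 else p i + 1)" by (rule s[OF i(2)])
  also have "\<dots> = i" unfolding p[OF assms(2)] using assms(2) n by auto
  finally show "s (p i) = i" .
  have "p (s i) = (if s i = 0 then n + 2 else s i - 1)" by (rule p[OF i(1)])
  also have "\<dots> = i" unfolding s[OF assms(2)] by auto
  finally show "p (s i) = i" .
  show "s i \<noteq> i" unfolding s[OF assms(2)] by auto
  show "p i \<noteq> i" unfolding p[OF assms(2)] by auto
  show "s i \<noteq> p i" unfolding s[OF assms(2)] p[OF assms(2)] by auto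
  have "s (s i) = (if s i = n + 2 then 0 else s i + 1)" by (rule s[OF i(1)])
  also have "\<dots> \<noteq> i" unfolding s[OF assms(2)] by auto
  finally show "s (s i) \<noteq> i" .
qed

text \<open>
  \<open>g i\<close> is the tournament on layer \<open>i\<close>, and \<open>f i\<close> is the set of those \<open>u\<close> for which the edge between
  layers \<open>i\<close> and \<open>i + 1\<close> is directed upwards.
\<close>

definition assemble :: "nat \<Rightarrow> nat \<Rightarrow> (nat \<Rightarrow> nat set) \<Rightarrow> (nat \<Rightarrow> (nat \<times> nat) set) \<Rightarrow>
    ((nat \<times> nat) \<times> (nat \<times> nat)) set" where
  "assemble m l f g = {((u, i), (v, j)). u < m \<and> v < m \<and> i < l \<and> j < l \<and>
     (i = j \<and> (u, v) \<in> g i \<or> u = v \<and> (j = Suc i mod l \<and> u \<in> f i \<or> i = Suc j mod l \<and> u \<notin> f j))}"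

text \<open>\<open>restrict\<close> makes the result extensional, so that it lies in the function
  space over which the count runs; likewise for \<open>layers\<close>.\<close>

definition up_arcs :: "nat \<Rightarrow> ((nat \<times> nat) \<times> (nat \<times> nat)) set \<Rightarrow> nat \<Rightarrow> nat set" where
  "up_arcs l A = restrict (\<lambda>i. {u. ((u, i), (u, Suc i mod l)) \<in> A}) {..<l}"

definition layers :: "nat \<Rightarrow> ((nat \<times> nat) \<times> (nat \<times> nat)) set \<Rightarrow> nat \<Rightarrow> (nat \<times> nat) set" where
  "layers l A = restrict (\<lambda>i. {(u, v). ((u, i), (v, i)) \<in> A}) {..<l}"

context
  fixes m l :: nat
  assumes l: "3 \<le> l"
begin

private abbreviation (input) "succ i \<equiv> Suc i mod l"
private abbreviation (input) "pred i \<equiv> (i + l - 1) mod l"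
private abbreviation (input) "G \<equiv> cart_prod (complete_graph m) (cycle_graph l)"

lemma is_orientation_assemble:
  assumes "\<And>i. i < l \<Longrightarrow> tournament {..<m} (g i)"
  shows "is_orientation G (assemble m l f g)"
proof -
  have mem: "((u, i), (v, j)) \<in> assemble m l f g \<longleftrightarrow> u < m \<and> v < m \<and> i < l \<and> j < l \<and>
     (i = j \<and> (u, v) \<in> g i \<or> u = v \<and> (j = succ i \<and> u \<in> f i \<or> i = succ j \<and> u \<notin> f j))" for u i v j
    by (simp add: assemble_def)
  have g: "(u, v) \<in> g i \<longleftrightarrow> u \<noteq> v \<and> (v, u) \<notin> g i" if "u < m" "v < m" "i < l" for u v i
    using assms[OF that(3)] that unfolding tournament_def by blast
  have "{(u, i), (v, j)} \<in> edges G" if "((u, i), (v, j)) \<in> assemble m l f g" for u i v j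
    using that g unfolding mem edges_cart_prod_complete_cycle[OF l] by blast
  moreover have "(((u, i), (v, j)) \<in> assemble m l f g) \<noteq> (((v, j), (u, i)) \<in> assemble m l f g)"
    if e: "{(u, i), (v, j)} \<in> edges G" for u i v j
  proof (cases "i = j")
    case True
    then show ?thesis using e g[of u v i] cyclic_succ(5)[OF l, of i]
      unfolding mem edges_cart_prod_complete_cycle[OF l] by auto
  next
    case False
    then have ij: "u = v" "i < l" "j < l" "u < m" "j = succ i \<or> i = succ j" using e
      unfolding edges_cart_prod_complete_cycle[OF l] by auto
    have "\<not> (j = succ i \<and> i = succ j)"
      using cyclic_succ(8)[OF l ij(2)] by auto
    then show ?thesis using ij False unfolding mem by auto
  qed
  ultimately show ?thesis unfolding is_orientation_def by auto
qed

lemma decompose_orientation: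
  assumes "is_orientation G A"
  shows "i < l \<Longrightarrow> up_arcs l A i \<subseteq> {..<m}" "i < l \<Longrightarrow> tournament {..<m} (layers l A i)"
    and "assemble m l (up_arcs l A) (layers l A) = A"
proof -
  have A1: "{x, y} \<in> edges G" if "(x, y) \<in> A" for x y
    using assms that unfolding is_orientation_def by auto
  have A2: "(x, y) \<in> A \<longleftrightarrow> (y, x) \<notin> A" if "{x, y} \<in> edges G" for x y
  proof -
    have "((x, y) \<in> A) \<noteq> ((y, x) \<in> A)" using assms that unfolding is_orientation_def by blast
    then show ?thesis by blast
  qed
  note E = edges_cart_prod_complete_cycle[OF l]
  show "up_arcs l A i \<subseteq> {..<m}" if "i < l"
    using A1 E that by (auto simp: up_arcs_def)
  show "tournament {..<m} (layers l A i)" if i: "i < l"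
    unfolding tournament_def
  proof (intro conjI ballI)
    show "layers l A i \<subseteq> {..<m} \<times> {..<m}" using A1 E i by (auto simp: layers_def)
    fix u v assume uv: "u \<in> {..<m}" "v \<in> {..<m}"
    show "(u, v) \<in> layers l A i \<longleftrightarrow> u \<noteq> v \<and> (v, u) \<notin> layers l A i"
    proof (cases "u = v")
      case True
      have "((u, i), (u, i)) \<notin> A" using A1[of "(u, i)" "(u, i)"] cyclic_succ(5)[OF l i] unfolding E
        by auto
      then show ?thesis using True i by (simp add: layers_def)
    next
      case False
      then have "{(u, i), (v, i)} \<in> edges G" using uv i unfolding E by simp
      then show ?thesis using A2 False i by (simp add: layers_def)
    qed
  qed
  show "assemble m l (up_arcs l A) (layers l A) = A"
  proof (intro set_eqI; clarify)
    fix u i v j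
    show "((u, i), (v, j)) \<in> assemble m l (up_arcs l A) (layers l A) \<longleftrightarrow> ((u, i), (v, j)) \<in> A" (is "?L
        \<longleftrightarrow> ?R")
    proof (cases "{(u, i), (v, j)} \<in> edges G")
      case False
      have "\<not> ?L"
      proof
        assume ?L
        then have "u < m" "v < m" "i < l" "j < l"
          and "i = j \<and> ((u, i), (v, i)) \<in> A \<or> u = v \<and> (j = succ i \<or> i = succ j)"
          by (auto simp: assemble_def layers_def)
        then show False using False A1[of "(u, i)" "(v, i)"] unfolding E by blast
      qed
      then show ?thesis using False A1 by blast
    next
      case True
      then have b: "u < m" "v < m" "i < l" "j < l" unfolding E by auto
      have L: "?L \<longleftrightarrow> i = j \<and> ((u, i), (v, i)) \<in> A \<or>
          u = v \<and> (j = succ i \<and> ((u, i), (u, j)) \<in> A \<or> i = succ j \<and> ((u, j), (u, i)) \<notin> A)"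
        using b by (auto simp: assemble_def layers_def up_arcs_def)
      show ?thesis
      proof (cases "i = j")
        case True
        then show ?thesis using cyclic_succ(5)[OF l b(3)] unfolding L by auto
      next
        case False
        then have "u = v" "j = succ i \<or> i = succ j" using \<open>{(u, i), (v, j)} \<in> edges G\<close> unfolding E
          by auto
        then show ?thesis using False A2[OF \<open>{(u, i), (v, j)} \<in> edges G\<close>] unfolding L by auto
      qed
    qed
  qed
qed

lemma decompose_assemble:
  assumes "f \<in> {..<l} \<rightarrow>\<^sub>E Pow {..<m}" "g \<in> extensional {..<l}" "\<And>i. i < l \<Longrightarrow> g i \<subseteq> {..<m} \<times> {..<m}"
  shows "up_arcs l (assemble m l f g) = f" "layers l (assemble m l f g) = g"
proof -
  show "up_arcs l (assemble m l f g) = f"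
  proof
    fix i show "up_arcs l (assemble m l f g) i = f i"
    proof (cases "i < l")
      case True
      have "f i \<subseteq> {..<m}" using assms(1) True by auto
      moreover note c = cyclic_succ(1,5,8)[OF l True]
      have "((u, i), (u, succ i)) \<in> assemble m l f g \<longleftrightarrow> u < m \<and> u \<in> f i" for u
        using True c(1,2) c(3)[symmetric] by (simp add: assemble_def)
      ultimately show ?thesis using True by (auto simp: up_arcs_def)
    qed (use assms(1) in \<open>auto simp: up_arcs_def PiE_def extensional_def\<close>)
  qed
  show "layers l (assemble m l f g) = g"
  proof
    fix i show "layers l (assemble m l f g) i = g i"
    proof (cases "i < l")
      case True
      have "((u, i), (v, i)) \<in> assemble m l f g \<longleftrightarrow> u < m \<and> v < m \<and> (u, v) \<in> g i" for u v
        using True cyclic_succ(5)[OF l True, symmetric] by (simp add: assemble_def)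
      then show ?thesis using True assms(3)[OF True] by (auto simp: layers_def)
    qed (use assms(2) in \<open>auto simp: layers_def extensional_def\<close>)
  qed
qed

text \<open>The edge to the layer above contributes 1 to the excess if \<open>u \<in> f i\<close>
  and \<open>- 1\<close> otherwise; the edge to the layer below contributes \<open>- 1\<close> if
  \<open>u \<in> f (pred i)\<close> and 1 otherwise.\<close>

lemma excess_assemble:
  assumes "\<And>i. i < l \<Longrightarrow> tournament {..<m} (g i)" "u < m" "i < l"
  shows "excess (assemble m l f g) (u, i) = excess (g i) u - shift (f (pred i)) (f i) u"
proof -
  let ?A = "assemble m l f g"
  define S P where "S = succ i" and "P = pred i"
  have c: "S < l" "P < l" "S \<noteq> i" "P \<noteq> i" "S \<noteq> P"
    using cyclic_succ[OF l assms(3)] unfolding S_def P_def by auto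
  note t = assms(1)[OF assms(3)]
  have sp: "i = succ j \<longleftrightarrow> j = P" if "j < l" for j
    using cyclic_succ(3)[OF l assms(3)] cyclic_succ(4)[OF l that] unfolding P_def by auto
  have gV: "(u, v) \<in> g i \<Longrightarrow> v < m" "(v, u) \<in> g i \<Longrightarrow> v < m" for v
    using tournamentD(1,2)[OF t] by auto
  have "((u, i), (v, j)) \<in> ?A \<longleftrightarrow> v < m \<and> j < l \<and>
      (i = j \<and> (u, v) \<in> g i \<or> u = v \<and> (j = S \<and> u \<in> f i \<or> j = P \<and> u \<notin> f j))" for v j
    by (cases "j < l") (simp_all add: assemble_def S_def sp assms(2,3))
  then have out: "((u, i), (v, j)) \<in> ?A \<longleftrightarrow>
      j = i \<and> (u, v) \<in> g i \<or> v = u \<and> j = S \<and> u \<in> f i \<or> v = u \<and> j = P \<and> u \<notin> f P" for v j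
    using assms(2,3) c(1,2) gV(1)[of v] by auto
  have "((v, j), (u, i)) \<in> ?A \<longleftrightarrow> v < m \<and> j < l \<and>
      (i = j \<and> (v, u) \<in> g i \<or> u = v \<and> (j = S \<and> u \<notin> f i \<or> j = P \<and> u \<in> f j))" for v j
    by (cases "j < l") (auto simp add: assemble_def S_def sp assms(2,3))
  then have inn: "((v, j), (u, i)) \<in> ?A \<longleftrightarrow>
      j = i \<and> (v, u) \<in> g i \<or> v = u \<and> j = S \<and> u \<notin> f i \<or> v = u \<and> j = P \<and> u \<in> f P" for v j
    using assms(2,3) c(1,2) gV(2)[of v] by auto
  have "{w. ((u, i), w) \<in> ?A} = (\<lambda>v. (v, i)) ` {v. (u, v) \<in> g i} \<union>
      ((if u \<in> f i then {(u, S)} else {}) \<union> (if u \<notin> f P then {(u, P)} else {}))"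
    by (auto simp: out)
  moreover have "{w. (w, (u, i)) \<in> ?A} = (\<lambda>v. (v, i)) ` {v. (v, u) \<in> g i} \<union>
      ((if u \<notin> f i then {(u, S)} else {}) \<union> (if u \<in> f P then {(u, P)} else {}))"
    by (auto simp: inn)
  moreover have "card ((\<lambda>v. (v, i)) ` R \<union> ((if p then {(u, S)} else {}) \<union> (if q then {(u, P)} else
      {})))
      = card R + of_bool p + of_bool q" if "finite R" for R :: "nat set" and p q
  proof -
    have "card ((\<lambda>v. (v, i)) ` R) = card R" by (intro card_image inj_onI) simp
    moreover have "card ((if p then {(u, S)} else {}) \<union> (if q then {(u, P)} else {}))
        = of_bool p + of_bool q"
      using c(5) by auto
    moreover have "(\<lambda>v. (v, i)) ` R \<inter> ((if p then {(u, S)} else {}) \<union> (if q then {(u, P)} else {}))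
        = {}"
      using c(3,4) by auto
    ultimately show ?thesis using that by (subst card_Un_disjoint) auto
  qed
  ultimately show ?thesis
    using finite_nbrs[OF finite_lessThan t, of u]
    unfolding excess_def out_deg_def in_deg_def shift_def P_def[symmetric] by simp
qed

text \<open>The right-hand side is the trace of the \<open>l\<close>-th power of the transfer
  matrix. Once the vertical directions \<open>f\<close> are fixed, balance prescribes the excesses
  within each layer, and the layers can be chosen independently.\<close>

lemma EO_complete_cycle:
  "EO G = (\<Sum>f\<in>{..<l} \<rightarrow>\<^sub>E Pow {..<m}. \<Prod>i<l. transfer {..<m} (f i) (f (succ i)))"
proof -
  let ?F = "{..<l} \<rightarrow>\<^sub>E Pow {..<m}"
  let ?H = "\<lambda>f. \<Pi>\<^sub>E i\<in>{..<l}. tours {..<m} (shift (f (pred i)) (f i))"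
  let ?O = "{A. is_orientation G A \<and> (\<forall>v \<in> verts G. in_deg A v = out_deg A v)}"
  have verts: "verts G = {..<m} \<times> {..<l}"
    by (simp add: cart_prod_def complete_graph_def cycle_graph_def)
  have bij: "bij_betw (\<lambda>(f, g). assemble m l f g) (Sigma ?F ?H) ?O"
  proof (rule bij_betw_byWitness[where f' = "\<lambda>A. (up_arcs l A, layers l A)"])
    show "\<forall>p\<in>Sigma ?F ?H. (\<lambda>A. (up_arcs l A, layers l A)) ((\<lambda>(f, g). assemble m l f g) p) = p"
    proof
      fix p assume "p \<in> Sigma ?F ?H"
      then obtain f g where p: "p = (f, g)" and fg: "f \<in> ?F" "g \<in> ?H f" by blast
      have "g i \<subseteq> {..<m} \<times> {..<m}" if "i < l" for i
        using PiE_mem[OF fg(2), of i] that by (simp add: tours_def tournament_def)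
      moreover have "g \<in> extensional {..<l}" using fg(2) by (simp add: PiE_def)
      ultimately show "(\<lambda>A. (up_arcs l A, layers l A)) ((\<lambda>(f, g). assemble m l f g) p) = p"
        using decompose_assemble[OF fg(1)] by (simp add: p)
    qed
    show "\<forall>A\<in>?O. (\<lambda>(f, g). assemble m l f g) (up_arcs l A, layers l A) = A"
      using decompose_orientation(3) by simp
    show "(\<lambda>(f, g). assemble m l f g) ` Sigma ?F ?H \<subseteq> ?O"
    proof (rule image_subsetI)
      fix p assume "p \<in> Sigma ?F ?H"
      then obtain f g where p: "p = (f, g)" and fg: "f \<in> ?F" "g \<in> ?H f" by blast
      have g: "g i \<in> tours {..<m} (shift (f (pred i)) (f i))" if "i < l" for i
        using PiE_mem[OF fg(2), of i] that by simp
      then have t: "tournament {..<m} (g i)" if "i < l" for i using that by (simp add: tours_def)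
      have "excess (assemble m l f g) v = 0" if v: "v \<in> verts G" for v
      proof -
        obtain u i where ui: "v = (u, i)" "u < m" "i < l" using v verts by auto
        show ?thesis unfolding ui(1)
          using excess_assemble[of g u i f, OF t ui(2,3)] g[OF ui(3)] ui(2) by (simp add: tours_def)
      qed
      then show "(case p of (f, g) \<Rightarrow> assemble m l f g) \<in> ?O"
        using is_orientation_assemble[of g f, OF t] unfolding p excess_def by force
    qed
    show "(\<lambda>A. (up_arcs l A, layers l A)) ` ?O \<subseteq> Sigma ?F ?H"
    proof (rule image_subsetI)
      fix A assume "A \<in> ?O"
      then have A: "is_orientation G A" and bal: "\<And>v. v \<in> verts G \<Longrightarrow> excess A v = 0"
        by (auto simp: excess_def)
      note d = decompose_orientation[OF A]
      have "up_arcs l A \<in> ?F" using d(1) by (auto simp: PiE_def up_arcs_def)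
      moreover have "layers l A i \<in> tours {..<m} (shift (up_arcs l A (pred i)) (up_arcs l A i))"
        if i: "i < l" for i
      proof -
        have "excess (layers l A i) u = shift (up_arcs l A (pred i)) (up_arcs l A i) u" if "u < m"
          for u
          using excess_assemble[of "layers l A" u i "up_arcs l A", OF d(2) that i]
            bal[of "(u, i)"] that i
          unfolding d(3) verts by simp
        then show ?thesis using d(2)[OF i] by (simp add: tours_def)
      qed
      then have "layers l A \<in> ?H (up_arcs l A)" by (auto simp: PiE_def layers_def)
      ultimately show "(up_arcs l A, layers l A) \<in> Sigma ?F ?H" by simp
    qed
  qed
  have "EO G = card (Sigma ?F ?H)"
    unfolding EO_def by (rule bij_betw_same_card[OF bij, symmetric])
  also have "\<dots> = (\<Sum>f\<in>?F. card (?H f))"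
    by (intro card_SigmaI ballI finite_PiE) auto
  also have "\<dots> = (\<Sum>f\<in>?F. \<Prod>i<l. transfer {..<m} (f (pred i)) (f i))"
    by (simp add: card_PiE)
  also have "\<dots> = (\<Sum>f\<in>?F. \<Prod>i<l. transfer {..<m} (f i) (f (succ i)))"
  proof (intro sum.cong refl)
    fix f :: "nat \<Rightarrow> nat set"
    have "bij_betw (\<lambda>i. succ i) {..<l} {..<l}"
      by (rule bij_betw_byWitness[where f' = "\<lambda>i. pred i"]) (use cyclic_succ[OF l] in auto)
    from prod.reindex_bij_betw[OF this, of "\<lambda>i. transfer {..<m} (f (pred i)) (f i)"]
    show "(\<Prod>i<l. transfer {..<m} (f (pred i)) (f i)) = (\<Prod>i<l. transfer {..<m} (f i) (f (succ i)))"
      using cyclic_succ(4)[OF l] by simp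
  qed
  finally show ?thesis .
qed

end

section \<open>Weights of closed walks\<close>

text \<open>
  Total weight of the walks with \<open>n\<close> steps, where \<open>g\<close> is an extra weight on the pair of end points;
  \<open>g x y = T y x\<close> closes the walk.
\<close>

definition walk_sum :: "('a \<Rightarrow> 'a \<Rightarrow> real) \<Rightarrow> 'a set \<Rightarrow> nat \<Rightarrow> ('a \<Rightarrow> 'a \<Rightarrow> real) \<Rightarrow> real" where
  "walk_sum T S n g = (\<Sum>f\<in>{..<Suc n} \<rightarrow>\<^sub>E S. (\<Prod>i<n. T (f i) (f (Suc i))) * g (f 0) (f n))"

lemma walk_sum_0: "walk_sum T S 0 g = (\<Sum>x\<in>S. g x x)"
proof -
  have "bij_betw (\<lambda>x. restrict (\<lambda>_. x) {..<Suc 0}) S ({..<Suc 0} \<rightarrow>\<^sub>E S)"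
    by (rule bij_betw_byWitness[where f' = "\<lambda>f. f 0"])
      (auto simp: fun_eq_iff PiE_def extensional_def)
  from sum.reindex_bij_betw[OF this, of "\<lambda>f. g (f 0) (f 0)"] show ?thesis
    by (simp add: walk_sum_def)
qed

text \<open>Summing out the last vertex folds the last step into the end weight, which is why
  \<open>g\<close> is kept arbitrary.\<close>

lemma walk_sum_Suc:
  "walk_sum T S (Suc n) g = walk_sum T S n (\<lambda>x z. \<Sum>y\<in>S. T z y * g x y)"
proof -
  let ?h = "\<lambda>(y, f). f(Suc n := y)"
  let ?P = "{..<Suc n} \<rightarrow>\<^sub>E S"
  have set: "{..<Suc (Suc n)} \<rightarrow>\<^sub>E S = ?h ` (S \<times> ?P)"
    unfolding lessThan_Suc[of "Suc n"] by (rule PiE_insert_eq)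
  have inj: "inj_on ?h (S \<times> ?P)"
    using inj_combinator[of "Suc n" "{..<Suc n}" "\<lambda>_. S"] by simp
  have "walk_sum T S (Suc n) g =
      (\<Sum>(y, f)\<in>S \<times> ?P. (\<Prod>i<n. T (f i) (f (Suc i))) * T (f n) y * g (f 0) y)"
    unfolding walk_sum_def set sum.reindex[OF inj]
  proof (rule sum.cong[OF refl])
    fix p assume "p \<in> S \<times> ?P"
    obtain y f where p: "p = (y, f)" by (cases p)
    have "(\<Prod>i<n. T ((f(Suc n := y)) i) ((f(Suc n := y)) (Suc i))) = (\<Prod>i<n. T (f i) (f (Suc i)))"
      by (intro prod.cong) auto
    then show "((\<lambda>f. (\<Prod>i<Suc n. T (f i) (f (Suc i))) * g (f 0) (f (Suc n))) \<circ> ?h) p =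
        (case p of (y, f) \<Rightarrow> (\<Prod>i<n. T (f i) (f (Suc i))) * T (f n) y * g (f 0) y)"
      by (simp add: p)
  qed
  also have "\<dots> = (\<Sum>f\<in>?P. \<Sum>y\<in>S. (\<Prod>i<n. T (f i) (f (Suc i))) * T (f n) y * g (f 0) y)"
    unfolding sum.cartesian_product[symmetric] by (rule sum.swap)
  finally show ?thesis by (simp add: walk_sum_def sum_distrib_left mult.assoc)
qed

text \<open>Every step summed out multiplies the bound on the end weight by \<open>r\<close>; in the
  end only the choice of the starting point remains.\<close>

lemma walk_sum_le:
  assumes "finite S" "\<And>x y. x \<in> S \<Longrightarrow> y \<in> S \<Longrightarrow> T x y \<ge> 0" "\<And>x. x \<in> S \<Longrightarrow> (\<Sum>y\<in>S. T x y) \<le> r"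
    and "0 \<le> c" "0 \<le> r" "\<And>x y. x \<in> S \<Longrightarrow> y \<in> S \<Longrightarrow> g x y \<le> c"
  shows "walk_sum T S n g \<le> real (card S) * (c * r ^ n)"
  using assms(4-6)
proof (induction n arbitrary: g c)
  case 0
  have "walk_sum T S 0 g \<le> (\<Sum>x\<in>S. c)" unfolding walk_sum_0 by (intro sum_mono 0)
  then show ?case by simp
next
  case (Suc n)
  have "(\<Sum>y\<in>S. T z y * g x y) \<le> r * c" if "x \<in> S" "z \<in> S" for x z
  proof -
    have "(\<Sum>y\<in>S. T z y * g x y) \<le> (\<Sum>y\<in>S. T z y * c)"
      using that assms(2) Suc.prems by (intro sum_mono mult_left_mono) auto
    also have "\<dots> \<le> r * c"
      unfolding sum_distrib_right[symmetric] using that assms(3) Suc.prems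
        by (intro mult_right_mono) auto
    finally show ?thesis .
  qed
  then have "walk_sum T S (Suc n) g \<le> real (card S) * ((r * c) * r ^ n)"
    unfolding walk_sum_Suc using Suc.prems by (intro Suc.IH) auto
  then show ?case by (simp add: mult_ac)
qed

lemma walk_sum_ge:
  assumes "finite S" "\<And>x y. x \<in> S \<Longrightarrow> y \<in> S \<Longrightarrow> T x y \<ge> 0" "\<And>x. x \<in> S \<Longrightarrow> (\<Sum>y\<in>S. T x y) = r"
    and "\<And>x y. x \<in> S \<Longrightarrow> y \<in> S \<Longrightarrow> c \<le> g x y"
  shows "real (card S) * (c * r ^ n) \<le> walk_sum T S n g"
  using assms(4)
proof (induction n arbitrary: g c)
  case 0
  have "(\<Sum>x\<in>S. c) \<le> walk_sum T S 0 g" unfolding walk_sum_0 by (intro sum_mono 0)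
  then show ?case by simp
next
  case (Suc n)
  have "r * c \<le> (\<Sum>y\<in>S. T z y * g x y)" if "x \<in> S" "z \<in> S" for x z
  proof -
    have "r * c = (\<Sum>y\<in>S. T z y * c)"
      unfolding sum_distrib_right[symmetric] using that assms(3) by simp
    also have "\<dots> \<le> (\<Sum>y\<in>S. T z y * g x y)"
      using that assms(2) Suc.prems by (intro sum_mono mult_left_mono) auto
    finally show ?thesis .
  qed
  then have "real (card S) * ((r * c) * r ^ n) \<le> walk_sum T S (Suc n) g"
    unfolding walk_sum_Suc by (intro Suc.IH) auto
  then show ?case by (simp add: mult_ac)
qed

lemma sum_cyclic_eq_walk_sum:
  "(\<Sum>f\<in>{..<Suc n} \<rightarrow>\<^sub>E S. \<Prod>i<Suc n. T (f i) (f (Suc i mod Suc n))) = walk_sum T S n (\<lambda>x y. T y x)"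
  unfolding walk_sum_def by (intro sum.cong refl) (simp add: lessThan_Suc mult.commute)

text \<open>Dropping \<open>X \<inter> Y\<close> from both sets leaves the entry unchanged, which
  reduces the claim to disjoint sets.\<close>

lemma transfer_le_transfer_empty:
  assumes "finite V" "X \<subseteq> V" "Y \<subseteq> V"
  shows "transfer V X Y \<le> transfer V {} {}"
proof (cases "card X = card Y")
  case True
  have d: "card (X - Y) = card (Y - X)"
    using True card_Int_Diff[OF finite_subset[OF assms(2,1)], of Y]
      card_Int_Diff[OF finite_subset[OF assms(3,1)], of X] by (simp add: Int_commute)
  have "X - Y - (Y - X) = X - Y" "Y - X - (X - Y) = Y - X" by auto
  then have "transfer V X Y = transfer V (X - Y) (Y - X)"
    using assms by (intro card_tours_shift) auto
  also have "\<dots> \<le> transfer V {} {}"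
    using assms d by (intro transfer_le_diag) auto
  finally show ?thesis .
qed (simp add: tours_shift_empty assms)

text \<open>This is \<open>transfer_ge_diag\<close> with \<open>z = k\<close>: for
  \<open>k > 0\<close> the distance is at most \<open>3 * k / 2\<close>, and
  \<open>16 * 3 / 2 = 24\<close>. The case \<open>k = 0\<close> is separate because \<open>z\<close>
  must be positive.\<close>

lemma transfer_ge_near_diagonal:
  assumes "finite V" "card V = 2 * k + 1" "X \<subseteq> V" "Y \<subseteq> V" "card X = k" "card Y = k"
    and "card (X - Y) \<le> k div 2 + 1"
  shows "real (transfer V X Y) \<ge> exp (- 24 * harm (card V)) * real (transfer V {} {})"
proof (cases "k = 0")
  case True
  then have "X = {}" "Y = {}" using assms finite_subset[OF _ assms(1)] by auto
  then show ?thesis using harm_nonneg[of "card V", where 'a = real]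
    by (simp add: mult_left_le_one_le)
next
  case False
  have d: "card (X - Y) = card (Y - X)"
    using assms(5,6) card_Int_Diff[OF finite_subset[OF assms(3,1)], of Y]
      card_Int_Diff[OF finite_subset[OF assms(4,1)], of X] by (simp add: Int_commute)
  have "X - Y - (Y - X) = X - Y" "Y - X - (X - Y) = Y - X" by auto
  then have eq: "transfer V X Y = transfer V (X - Y) (Y - X)"
    using assms by (intro card_tours_shift) auto
  have "2 * card (X - Y) \<le> 3 * k" "k + 2 * card (X - Y) \<le> card V + 1"
    using assms(2,7) False by linarith+
  then have "real (card (X - Y)) / real k \<le> 3 / 2" using False by (simp add: field_simps)
  then have "(16 * harm (card V)) * (real (card (X - Y)) / real k) \<le> (16 * harm (card V)) * (3 / 2)"
    using harm_nonneg[of "card V", where 'a = real] by (intro mult_left_mono) auto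
  then have "- 24 * harm (card V) \<le> - 16 * real (card (X - Y)) * harm (card V) / real k"
    by (simp add: mult_ac)
  then have "exp (- 24 * harm (card V)) * real (transfer V {} {})
      \<le> exp (- 16 * real (card (X - Y)) * harm (card V) / real k) * real (transfer V {} {})"
    by (intro mult_right_mono) auto
  also have "\<dots> \<le> real (transfer V (X - Y) (Y - X))"
    using assms d False \<open>k + 2 * card (X - Y) \<le> card V + 1\<close> by (intro transfer_ge_diag) auto
  finally show ?thesis unfolding eq .
qed

lemma harm_le_ln:
  assumes "n > 0"
  shows "harm n \<le> ln (real n) + 1"
proof -
  obtain k where "n = Suc k" using assms gr0_implies_Suc by blast
  then show ?thesis using decseqD[OF decseq_harm_diff_ln, of 0 k] by (simp add: harm_expand)
qed

section \<open>Comparison of the count with a power of the largest row sum\<close>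

context
  fixes m k l :: nat
  assumes m: "m = 2 * k + 1" and l: "3 \<le> l"
begin

private abbreviation (input) "V \<equiv> {..<m}"
private abbreviation (input) "t0 \<equiv> real (transfer V {} {})"
private abbreviation (input) "S \<equiv> {y. y \<subseteq> V \<and> card y = k}"
private abbreviation (input) "lam \<equiv> \<Sum>y\<in>S. real (transfer V {..<k} y)"
private abbreviation (input) "decay \<equiv> exp (- 24 * harm m :: real)"
private abbreviation (input) "B \<equiv> 2 ^ m / real (m + 1) ^ 4"

text \<open>There are \<open>2 ^ m\<close> starting sets, each of the \<open>l - 1\<close> open
  steps costs at most a row sum \<open>lam\<close>, and the closing entry is at most
  \<open>t0\<close>.\<close>

lemma EO_le: "real (EO (cart_prod (complete_graph m) (cycle_graph l)))
    \<le> 2 ^ m * (t0 * lam ^ (l - 1))"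
proof -
  obtain n where n: "l = Suc n" using l by (cases l) auto
  have "real (EO (cart_prod (complete_graph m) (cycle_graph l)))
      = walk_sum (\<lambda>x y. real (transfer V x y)) (Pow V) n (\<lambda>x y. real (transfer V y x))"
    using EO_complete_cycle[OF l, of m] unfolding n sum_cyclic_eq_walk_sum[symmetric]
      by (simp only: of_nat_sum of_nat_prod)
  also have "\<dots> \<le> real (card (Pow V)) * (t0 * lam ^ n)"
  proof (rule walk_sum_le)
    fix x assume "x \<in> Pow V"
    then show "(\<Sum>y\<in>Pow V. real (transfer V x y)) \<le> lam"
      using sum_transfer_le_middle(1)[of V k x "{..<k}"] m
        unfolding of_nat_sum[symmetric] of_nat_le_iff by auto
  qed (use transfer_le_transfer_empty[of V] in \<open>auto intro: sum_nonneg\<close>)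
  finally show ?thesis by (simp add: n card_Pow)
qed

lemma card_near_ge:
  assumes "x \<in> S" "y \<in> S"
  shows "B \<le> real (card {z. z \<subseteq> V \<and> card z = k \<and> card (x - z) \<le> k div 2 + 1 \<and> card (y - z) \<le> k div 2
      + 1})"
proof -
  have "2 ^ m \<le> card {z. z \<subseteq> V \<and> card z = k \<and> card (x - z) \<le> k div 2 + 1 \<and> card (y - z) \<le> k div 2 +
      1} * (m + 1) ^ 4"
    using card_middle_ge[of V k x y] assms m by simp
  then have "real (2 ^ m) \<le> real
      (card {z. z \<subseteq> V \<and> card z = k \<and> card (x - z) \<le> k div 2 + 1 \<and> card (y - z) \<le> k div 2 + 1} * (m +
        1) ^ 4)"
    by (simp only: of_nat_le_iff)
  then show ?thesis by (simp add: pos_divide_le_eq)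
qed

lemma lam_ge: "lam \<ge> B * (decay * t0)"
proof -
  \<comment> \<open>The condition occurs twice because \<open>card_near_ge\<close> is applied with
    both sets equal to \<open>{..<k}\<close>.\<close>
  let ?M = "{z. z \<subseteq> V \<and> card z = k \<and> card ({..<k} - z) \<le> k div 2 + 1 \<and> card ({..<k} - z) \<le> k div 2 +
      1}"
  have k: "{..<k} \<in> S" using m by auto
  have "B * (decay * t0) \<le> real (card ?M) * (decay * t0)"
    using card_near_ge[OF k k] by (intro mult_right_mono) auto
  also have "\<dots> = (\<Sum>z\<in>?M. decay * t0)" by simp
  also have "\<dots> \<le> (\<Sum>z\<in>?M. real (transfer V {..<k} z))"
    using transfer_ge_near_diagonal[of V k "{..<k}"] m k by (intro sum_mono) auto
  also have "\<dots> \<le> lam"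
    by (intro sum_mono2) auto
  finally show ?thesis .
qed

lemma lam_le: "lam \<le> real (card S) * t0"
  using sum_bounded_above[of S "\<lambda>y. real (transfer V {..<k} y)" t0]
    transfer_le_transfer_empty[of V "{..<k}"] m
  by auto

text \<open>Only walks through \<open>k\<close>-sets are kept, where all row sums equal
  \<open>lam\<close>. They are closed by two steps rather than one: the end points may be far apart,
  but at least \<open>B\<close> sets are near both, and each of these contributes at least
  \<open>(decay * t0)\<^sup>2\<close>.\<close>

lemma EO_ge: "real (card S) * (B * (decay * t0)\<^sup>2 * lam ^ (l - 2))
    \<le> real (EO (cart_prod (complete_graph m) (cycle_graph l)))"
proof -
  obtain n where n: "l = Suc (Suc n)" using l
    by (metis Suc_le_D add_2_eq_Suc' eval_nat_numeral(3) Suc_le_mono numeral_2_eq_2)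
  let ?T = "\<lambda>x y. real (transfer V x y)"
  have "real (card S) * (B * (decay * t0)\<^sup>2 * lam ^ n)
      \<le> walk_sum ?T S n (\<lambda>x z. \<Sum>y\<in>S. ?T z y * ?T y x)"
  proof (rule walk_sum_ge)
    fix x assume "x \<in> S"
    then show "(\<Sum>y\<in>S. ?T x y) = lam"
      using sum_transfer_le_middle(2)[of V k x "{..<k}"] m
        unfolding of_nat_sum[symmetric] of_nat_eq_iff by auto
  next
    fix x z assume xz: "x \<in> S" "z \<in> S"
    let ?M = "{y. y \<subseteq> V \<and> card y = k \<and> card (z - y) \<le> k div 2 + 1 \<and> card (x - y) \<le> k div 2 + 1}"
    have "B * (decay * t0)\<^sup>2 \<le> real (card ?M) * (decay * t0)\<^sup>2"
      using card_near_ge[OF xz(2,1)] by (intro mult_right_mono) auto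
    also have "\<dots> = (\<Sum>y\<in>?M. (decay * t0) * (decay * t0))" by (simp add: power2_eq_square)
    also have "\<dots> \<le> (\<Sum>y\<in>?M. ?T z y * ?T y x)"
    proof (intro sum_mono mult_mono)
      fix y assume y: "y \<in> ?M"
      show "decay * t0 \<le> ?T z y"
        using transfer_ge_near_diagonal[of V k z y] m xz y by auto
      have "transfer V y x = transfer V x y" using xz y by (intro transfer_commute) auto
      then show "decay * t0 \<le> ?T y x"
        using transfer_ge_near_diagonal[of V k x y] m xz y by auto
    qed auto
    also have "\<dots> \<le> (\<Sum>y\<in>S. ?T z y * ?T y x)"
      by (intro sum_mono2) auto
    finally show "B * (decay * t0)\<^sup>2 \<le> (\<Sum>y\<in>S. ?T z y * ?T y x)" .
  qed auto
  also have "\<dots> = (\<Sum>f\<in>{..<l} \<rightarrow>\<^sub>E S. \<Prod>i<l. ?T (f i) (f (Suc i mod l)))"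
    unfolding walk_sum_Suc[symmetric] sum_cyclic_eq_walk_sum[symmetric] n ..
  also have "\<dots> \<le> (\<Sum>f\<in>{..<l} \<rightarrow>\<^sub>E Pow V. \<Prod>i<l. ?T (f i) (f (Suc i mod l)))"
    by (intro sum_mono2 finite_PiE PiE_mono prod_nonneg) auto
  also have "\<dots> = real (EO (cart_prod (complete_graph m) (cycle_graph l)))"
    unfolding EO_complete_cycle[OF l] by simp
  finally show ?thesis using n by simp
qed

text \<open>With \<open>q = (m + 1) ^ 4\<close>, the count divided by \<open>lam ^ l\<close> is at
  most \<open>q / decay\<close> by \<open>EO_le\<close> and \<open>lam_ge\<close>, and at least
  \<open>decay\<^sup>2 / q\<close> by \<open>EO_ge\<close> and \<open>lam_le\<close>. As
  \<open>harm m \<le> ln m + 1\<close>, the logarithm of \<open>1 / decay\<close> costs 48 and that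
  of \<open>q\<close> costs 8, so the lower bound gives \<open>104 = 2 * 48 + 8\<close>.\<close>

lemma ln_EO_close:
  "\<bar>ln (real (EO (cart_prod (complete_graph m) (cycle_graph l)))) - real l * ln lam\<bar>
      \<le> 104 * max 1 (ln (real m))"
proof (cases "t0 = 0")
  case True
  \<comment> \<open>Then both logarithms have the junk value \<open>ln 0 = 0\<close>.\<close>
  have "lam = 0" using lam_le True sum_nonneg[of S "\<lambda>y. real (transfer V {..<k} y)"] by simp
  moreover have "real (EO (cart_prod (complete_graph m) (cycle_graph l))) = 0" using EO_le True
    by simp
  ultimately show ?thesis by simp
next
  case False
  define E where "E = real (EO (cart_prod (complete_graph m) (cycle_graph l)))"
  define r where "r = lam"
  define t a M where "t = t0" and "a = decay" and "M = max 1 (ln (real m))"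
  define q where "q = real (m + 1) ^ 4"
  have pos: "t > 0" "a > 0" "q > 0" using False by (auto simp: t_def a_def q_def)
  have r1: "2 ^ m * t \<le> r * (q / a)"
    using lam_ge pos unfolding r_def[symmetric] t_def[symmetric] a_def[symmetric] q_def[symmetric]
    by (simp add: field_simps)
  have "0 < 2 ^ m * t" using pos by simp
  then have r: "r > 0" using r1 pos
    by (metis less_le_trans zero_less_divide_iff zero_less_mult_pos2)
  have n: "real (card S) \<le> 2 ^ m" using n_subsets[of V k] binomial_le_pow2[of m k] by simp
  have upper: "E \<le> r ^ l * (q / a)"
  proof -
    have "E \<le> (2 ^ m * t) * r ^ (l - 1)" using EO_le unfolding E_def r_def t_def
      by (simp add: mult_ac)
    also have "\<dots> \<le> (r * (q / a)) * r ^ (l - 1)" using r1 r by (intro mult_right_mono) auto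
    also have "\<dots> = r ^ l * (q / a)" using l by (simp add: power_eq_if)
    finally show ?thesis .
  qed
  have lower: "r ^ l * (a\<^sup>2 / q) \<le> E"
  proof -
    \<comment> \<open>This trades the factor \<open>real (card S) * 2 ^ m * t\<^sup>2\<close> in
      \<open>EO_ge\<close> for \<open>r\<^sup>2\<close>, which completes the power
      \<open>r ^ l\<close>.\<close>
    have "r\<^sup>2 \<le> (real (card S) * t)\<^sup>2" using lam_le r unfolding r_def t_def
      by (intro power_mono) auto
    also have "\<dots> = real (card S) * real (card S) * t\<^sup>2" by (simp add: power2_eq_square)
    also have "\<dots> \<le> real (card S) * 2 ^ m * t\<^sup>2" using n
      by (intro mult_right_mono mult_left_mono) auto
    finally have "r\<^sup>2 * (a\<^sup>2 / q * r ^ (l - 2))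
        \<le> real (card S) * 2 ^ m * t\<^sup>2 * (a\<^sup>2 / q * r ^ (l - 2))"
      using r pos by (intro mult_right_mono) auto
    also have "\<dots> = real (card S) * (2 ^ m / q * (a * t)\<^sup>2 * r ^ (l - 2))"
      by (simp add: power2_eq_square mult_ac)
    also have "\<dots> \<le> E" using EO_ge unfolding E_def r_def t_def a_def q_def .
    finally have "r\<^sup>2 * (a\<^sup>2 / q * r ^ (l - 2)) \<le> E" .
    moreover have "2 + (l - 2) = l" using l by simp
    then have "r ^ l = r\<^sup>2 * r ^ (l - 2)" using power_add[of r 2 "l - 2"] by (simp only:)
    ultimately show ?thesis by (simp add: mult_ac)
  qed
  have E: "E > 0" using less_le_trans[OF _ lower] r pos by simp
  have m0: "m > 0" using m by simp
  have lnq: "ln q \<le> 8 * M"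
  proof -
    have "ln (real (m + 1)) \<le> ln (2 * real m)" using m0 by (subst ln_le_cancel_iff) auto
    also have "\<dots> = ln 2 + ln (real m)" using m0 by (simp add: ln_mult)
    also have "\<dots> \<le> 2 * M" using ln_le_minus_one[of 2] by (simp add: M_def)
    finally show ?thesis unfolding q_def by (simp add: ln_realpow)
  qed
  have lna: "- ln a \<le> 48 * M" "ln a \<le> 0"
    using harm_le_ln[OF m0] harm_nonneg[of m, where 'a = real] by (auto simp: a_def M_def)
  have "ln E \<le> ln (r ^ l * (q / a))" using upper E by simp
  also have "\<dots> = real l * ln r + ln q - ln a"
    using r pos by (simp add: ln_mult ln_div ln_realpow)
  finally have 1: "ln E - real l * ln r \<le> 104 * M" using lnq lna by linarith
  have "ln (r ^ l * (a\<^sup>2 / q)) \<le> ln E" using lower E r pos by simp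
  also have "ln (r ^ l * (a\<^sup>2 / q)) = real l * ln r + 2 * ln a - ln q"
    using r pos by (simp add: ln_mult ln_div ln_realpow)
  finally have "- (104 * M) \<le> ln E - real l * ln r" using lnq lna by linarith
  with 1 show ?thesis unfolding E_def r_def M_def by (simp add: abs_le_iff)
qed

text \<open>\<open>RT_eq\<close> identifies the quotient inside the logarithm as \<open>lam\<close>;
  then \<open>ln_EO_close\<close> is divided by the number \<open>m * l\<close> of vertices.\<close>

lemma rho_bound:
  "\<bar>rho (cart_prod (complete_graph m) (cycle_graph l)) -
      1 / real m * ln (real (RT (m + 2)) / real ((m + 1) choose ((m + 1) div 2)))\<bar>
    \<le> 104 * (max 1 (ln (real m)) / (real m * real l))"
proof -
  have half: "(m + 1) div 2 = k + 1" using m by simp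
  have "RT (m + 2) = ((m + 1) choose (k + 1)) * (\<Sum>y\<in>S. transfer V {..<k} y)"
    by (rule RT_eq[OF m]) (use m in auto)
  then have prod: "real (RT (m + 2)) = real ((m + 1) choose (k + 1)) * lam"
    by (simp only: of_nat_mult of_nat_sum)
  have "real ((m + 1) choose (k + 1)) \<noteq> 0"
    using m zero_less_binomial[of "k + 1" "m + 1"] by linarith
  then have RT: "real (RT (m + 2)) / real ((m + 1) choose ((m + 1) div 2)) = lam"
    unfolding half prod by (rule nonzero_mult_div_cancel_left)
  have cV: "card (verts (cart_prod (complete_graph m) (cycle_graph l))) = m * l"
    by (simp add: cart_prod_def complete_graph_def cycle_graph_def card_cartesian_product)
  have frac_diff: "x / (a * b) - 1 / a * y = (x - b * y) / (a * b)" if "a > 0" "b > 0"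
    for a b x y :: real
    using that by (simp add: field_simps)
  have "rho (cart_prod (complete_graph m) (cycle_graph l)) - 1 / real m * ln lam =
      (ln (real (EO (cart_prod (complete_graph m) (cycle_graph l)))) - real l * ln lam) /
        (real m * real l)"
    unfolding rho_def cV of_nat_mult by (rule frac_diff) (use l m in auto)
  then have "\<bar>rho (cart_prod (complete_graph m) (cycle_graph l)) - 1 / real m * ln lam\<bar> =
      \<bar>ln (real (EO (cart_prod (complete_graph m) (cycle_graph l)))) - real l * ln lam\<bar> /
        (real m * real l)"
    by (simp add: abs_divide)
  also have "\<dots> \<le> 104 * max 1 (ln (real m)) / (real m * real l)"
    by (intro divide_right_mono ln_EO_close) simp
  finally show ?thesis unfolding RT by simp
qed

end

text \<open>The filter expresses that \<open>m * l\<close> tends to infinity along pairs with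
  \<open>m\<close> odd and \<open>l \<ge> 3\<close>, so either factor may grow, or both.\<close>

theorem theorem7p1:
  "(\<lambda>(m :: nat, l :: nat).
      rho (cart_prod (complete_graph m) (cycle_graph l)) -
      1 / real m * ln (real (RT (m + 2)) / real ((m + 1) choose ((m + 1) div 2))))
   \<in> O[inf (filtercomap (\<lambda>(m, l). m * l) at_top) (principal {(m, l). odd m \<and> 3 \<le> l})](
       \<lambda>(m, l). max 1 (ln (real m)) / (real m * real l))"
proof (rule bigoI[where c = 104])
  have "norm (case (m, l) of (m, l) \<Rightarrow> rho (cart_prod (complete_graph m) (cycle_graph l)) -
        1 / real m * ln (real (RT (m + 2)) / real ((m + 1) choose ((m + 1) div 2))))
      \<le> 104 * norm (case (m, l) of (m, l) \<Rightarrow> max 1 (ln (real m)) / (real m * real l))"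
    if "odd m" "3 \<le> l" for m l :: nat
  proof -
    obtain k where "m = 2 * k + 1" using \<open>odd m\<close> by (rule oddE)
    from rho_bound[OF this \<open>3 \<le> l\<close>] show ?thesis by simp
  qed
  then show "eventually (\<lambda>x. norm (case x of (m, l) \<Rightarrow> rho (cart_prod (complete_graph m) (cycle_graph
      l)) -
        1 / real m * ln (real (RT (m + 2)) / real ((m + 1) choose ((m + 1) div 2))))
      \<le> 104 * norm (case x of (m, l) \<Rightarrow> max 1 (ln (real m)) / (real m * real l)))
    (inf (filtercomap (\<lambda>(m, l). m * l) at_top) (principal {(m, l). odd m \<and> 3 \<le> l}))"
    unfolding eventually_inf_principal by (intro always_eventually) auto
qed

end
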